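(* Let $0<\alpha<n$ and $1<p\le q<\infty$, and suppose $$\min\Big(\frac{q}{p},\frac{p'}{q'}\Big)\Big(1-\frac{\alpha}{n}\Big)\ge 1.$$ Let $\delta>0$, $\Phi(t)=t^q\big(\log(e+t)\big)^{q-1+\delta}$ and $\Psi(t)=t^{p'}\big(\log(e+t)\big)^{p'-1+\delta}$. Then for every pair of weights $(u,\sigma)$ that satisfies $$\sup_Q|Q|^{\frac{\alpha}{n}+\frac1q-\frac1p}\,\|u^{\frac1q}\|_{\Phi,Q}\,\|\sigma^{\frac1{p'}}\|_{p',Q}<\infty$$ and $$\sup_Q|Q|^{\frac{\alpha}{n}+\frac1q-\frac1p}\,\|u^{\frac1q}\|_{q,Q}\,\|\sigma^{\frac1{p'}}\|_{\Psi,Q}<\infty,$$ there is a constant $C<\infty$ such that for all $f\in L^p(\sigma)$, $$\|I_\alpha(f\sigma)\|_{L^{q}(u)}\le C\,\|f\|_{L^p(\sigma)}.$$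
   Context: All functions are on $\mathbb{R}^n$; suprema are over all cubes $Q\subset\mathbb{R}^n$ with sides parallel to the axes. A weight is a non-negative locally integrable function. For $1<r<\infty$, $r'=r/(r-1)$. Riesz potential: $I_\alpha f(x)=\int_{\mathbb{R}^n}\frac{f(y)}{|x-y|^{n-\alpha}}\,dy$. Localized Luxemburg norm: $\|f\|_{\Phi,Q}=\inf\{\lambda>0:\frac1{|Q|}\int_Q\Phi(|f(x)|/\lambda)\,dx\le1\}$ (similarly for $\Psi$); for $1<r<\infty$, $\|f\|_{r,Q}=\big(\frac1{|Q|}\int_Q|f|^r\,dx\big)^{1/r}$. $\|f\|_{L^p(\sigma)}=(\int|f|^p\sigma\,dx)^{1/p}$ and $\|g\|_{L^q(u)}=(\int|g|^q u\,dx)^{1/q}$. *)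

theory Defs
  imports "HOL-Analysis.Analysis"
begin

text \<open>
  Norms and suprema take values in \<^typ>\<open>ennreal\<close>, since they may be infinite; there an empty
  infimum is \<^term>\<open>\<infinity>\<close> and \<open>0 * \<infinity> = 0\<close>. All integrals are with respect to Lebesgue measure.
\<close>

definition cubes :: "(real ^ 'n) set set" where
  "cubes = {cbox a (a + (\<chi> i. l)) | a l. 0 < l}"

definition weight :: "(real ^ 'n \<Rightarrow> real) \<Rightarrow> bool" where
  "weight w \<longleftrightarrow> (\<forall>x. 0 \<le> w x) \<and> (\<forall>K. compact K \<longrightarrow> w absolutely_integrable_on K)"

definition conj_exp :: "real \<Rightarrow> real" where
  "conj_exp r = r / (r - 1)"

(* Real powers on the extended half-line; only used with exponent a > 0. *)
definition epowr :: "ennreal \<Rightarrow> real \<Rightarrow> ennreal" where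
  "epowr x a = (if x = \<infinity> then \<infinity> else ennreal (enn2real x powr a))"

definition weighted_norm :: "real \<Rightarrow> (real ^ 'n \<Rightarrow> real) \<Rightarrow> (real ^ 'n \<Rightarrow> real) \<Rightarrow> ennreal" where
  "weighted_norm p w f = epowr (\<integral>\<^sup>+ x. ennreal (\<bar>f x\<bar> powr p * w x) \<partial>lebesgue) (1 / p)"

definition weighted_Lp :: "real \<Rightarrow> (real ^ 'n \<Rightarrow> real) \<Rightarrow> (real ^ 'n \<Rightarrow> real) set" where
  "weighted_Lp p w = {f \<in> borel_measurable lebesgue. weighted_norm p w f < \<infinity>}"

definition average :: "(real ^ 'n) set \<Rightarrow> (real ^ 'n \<Rightarrow> real) \<Rightarrow> ennreal" where
  "average Q f = (\<integral>\<^sup>+ x\<in>Q. ennreal (f x) \<partial>lebesgue) / emeasure lebesgue Q"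

definition local_norm :: "real \<Rightarrow> (real ^ 'n) set \<Rightarrow> (real ^ 'n \<Rightarrow> real) \<Rightarrow> ennreal" where
  "local_norm r Q f = epowr (average Q (\<lambda>x. \<bar>f x\<bar> powr r)) (1 / r)"

definition luxemburg_norm ::
    "(real \<Rightarrow> real) \<Rightarrow> (real ^ 'n) set \<Rightarrow> (real ^ 'n \<Rightarrow> real) \<Rightarrow> ennreal" where
  "luxemburg_norm \<Phi> Q f =
     Inf {ennreal c | c. 0 < c \<and> average Q (\<lambda>x. \<Phi> (\<bar>f x\<bar> / c)) \<le> 1}"

definition log_bump :: "real \<Rightarrow> real \<Rightarrow> real \<Rightarrow> real" where
  "log_bump r \<delta> t = t powr r * (ln (exp 1 + t)) powr (r - 1 + \<delta>)"

definition riesz_kernel :: "real \<Rightarrow> real ^ 'n \<Rightarrow> real ^ 'n \<Rightarrow> real" where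
  "riesz_kernel \<alpha> x y = 1 / norm (x - y) powr (real CARD('n) - \<alpha>)"

(* The Bochner integral is 0 where the integrand is not integrable, so a statement about the
   potential should be accompanied by a convergence claim (riesz_converges). *)
definition riesz_potential :: "real \<Rightarrow> (real ^ 'n \<Rightarrow> real) \<Rightarrow> real ^ 'n \<Rightarrow> real" where
  "riesz_potential \<alpha> f x = (\<integral> y. f y * riesz_kernel \<alpha> x y \<partial>lebesgue)"

definition riesz_converges :: "real \<Rightarrow> (real ^ 'n \<Rightarrow> real) \<Rightarrow> real ^ 'n \<Rightarrow> bool" where
  "riesz_converges \<alpha> f x \<longleftrightarrow> integrable lebesgue (\<lambda>y. f y * riesz_kernel \<alpha> x y)"

end

theory Submission
  imports Defs
begin

text \<open>
  The condition on the minimum forces \<open>p < q\<close>. Write \<open>w(Q) = |Q|\<^bsup>\<alpha>/n - 1\<^esup>\<close>, \<open>\<sigma>(Q)\<close> and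
  \<open>u(Q)\<close> for the masses of a cube. A logarithmic bump measures concentration: if \<open>R \<subseteq> Q\<close> and
  \<open>|R| \<le> 2\<^bsup>-k\<^esup> |Q|\<close>, the first bump condition gives
  \<open>w(Q) \<sigma>(Q)\<^bsup>1/p'\<^esup> u(R)\<^bsup>1/q\<^esup> \<lesssim> (k + 1)\<^bsup>-(q-1+\<delta>)/q\<^esup>\<close>, whose \<open>p'\<close>-th powers are summable, and the second one
  gives the same with the roles of the weights exchanged. Along a chain \<open>Q\<^sub>0 \<supset> Q\<^sub>1 \<supset> \<dots>\<close> of dyadic cubes
  these are the Muckenhoupt conditions of two discrete Hardy inequalities, so that, with
  \<open>F = |f|\<^bsup>p\<^esup> \<sigma>\<close> and \<open>G = |g|\<^bsup>q'\<^esup> u\<close>, the part of the bilinear form \<open>\<Sum>\<^sub>Q w(Q) \<integral>\<^sub>Q f\<sigma> \<integral>\<^sub>Q gu\<close> that belongs to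
  the chain is at most a constant times \<open>F(Q\<^sub>0)\<^bsup>1/p\<^esup> G(Q\<^sub>0)\<^bsup>1/q'\<^esup>\<close>. Normalise \<open>F\<close> and \<open>G\<close> to total mass 1. The
  dyadic cubes with \<open>2\<^bsup>-i-1\<^esup> < F(Q) + G(Q) \<le> 2\<^bsup>-i\<^esup>\<close> form disjoint chains, because two disjoint ones do not fit
  into a third; there are at most \<open>2\<^bsup>i+2\<^esup>\<close> of these chains, so this level contributes at most a constant times
  \<open>2\<^bsup>-i(1/p - 1/q)\<^esup>\<close>. This is summable as \<open>p < q\<close>. Finitely many shifted dyadic grids dominate the Riesz kernel.
\<close>

subsection \<open>Hardy's inequality along a chain\<close>

lemma powr_mult_powr_le_add:
  fixes x y a :: real
  assumes "0 \<le> x" "0 \<le> y" "0 < a" "a < 1"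
  shows "x powr a * y powr (1 - a) \<le> a * x + (1 - a) * y"
proof (cases "x = 0 \<or> y = 0")
  case False
  then show ?thesis
    using Youngs_inequality_0[of a "1 - a" x y] assms by auto
qed (use assms in auto)

text \<open>After division by the two integrals, the weighted arithmetic-geometric mean integrates
  to \<open>a + (1 - a) = 1\<close>. This is Hoelder's inequality with exponents
  \<open>1 / a\<close> and \<open>1 / (1 - a)\<close>, kept in terms of densities because |f|
  \<sigma> will arise as such a product.\<close>

lemma integral_powr_mult_powr:
  fixes \<phi> \<sigma> :: "'a \<Rightarrow> real"
  assumes \<phi>: "integrable M \<phi>" "\<And>x. 0 \<le> \<phi> x" and \<sigma>: "integrable M \<sigma>" "\<And>x. 0 \<le> \<sigma> x"
    and a: "0 < a" "a < 1"
  shows "integrable M (\<lambda>x. \<phi> x powr a * \<sigma> x powr (1 - a))" (is "integrable M ?h")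
    and "(\<integral>x. \<phi> x powr a * \<sigma> x powr (1 - a) \<partial>M) \<le> (\<integral>x. \<phi> x \<partial>M) powr a * (\<integral>x. \<sigma> x \<partial>M) powr (1 - a)"
proof -
  have [measurable]: "\<phi> \<in> borel_measurable M" "\<sigma> \<in> borel_measurable M"
    using \<phi> \<sigma> by auto
  have le: "?h x \<le> a * \<phi> x + (1 - a) * \<sigma> x" for x
    using \<phi> \<sigma> a by (intro powr_mult_powr_le_add) auto
  show int: "integrable M ?h"
  proof (rule Bochner_Integration.integrable_bound)
    show "integrable M (\<lambda>x. a * \<phi> x + (1 - a) * \<sigma> x)" using \<phi> \<sigma> by auto
    show "AE x in M. norm (?h x) \<le> norm (a * \<phi> x + (1 - a) * \<sigma> x)"
    proof (rule AE_I2)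
      fix x
      have "0 \<le> ?h x" by simp
      with le[of x] show "norm (?h x) \<le> norm (a * \<phi> x + (1 - a) * \<sigma> x)" by simp
    qed
  qed simp
  define X where "X = (\<integral>x. \<phi> x \<partial>M)"
  define Y where "Y = (\<integral>x. \<sigma> x \<partial>M)"
  have XY: "0 \<le> X" "0 \<le> Y" using \<phi> \<sigma> by (auto simp: X_def Y_def)
  have zero: "(\<integral>x. ?h x \<partial>M) = 0" if "(AE x in M. \<phi> x = 0) \<or> (AE x in M. \<sigma> x = 0)"
  proof -
    have "AE x in M. ?h x = 0" using that by (auto elim!: AE_mp)
    then show ?thesis by (rule integral_eq_zero_AE)
  qed
  show "(\<integral>x. ?h x \<partial>M) \<le> X powr a * Y powr (1 - a)"
  proof (cases "X = 0 \<or> Y = 0")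
    case True
    then have "(AE x in M. \<phi> x = 0) \<or> (AE x in M. \<sigma> x = 0)"
      using integral_nonneg_eq_0_iff_AE[OF \<phi>(1)] integral_nonneg_eq_0_iff_AE[OF \<sigma>(1)] \<phi> \<sigma>
      by (auto simp: X_def Y_def)
    with zero show ?thesis by simp
  next
    case False
    with XY have pos: "0 < X" "0 < Y" by auto
    define c where "c = X powr a * Y powr (1 - a)"
    have c: "0 < c" using pos by (simp add: c_def)
    have "(\<integral>x. ?h x \<partial>M) \<le> (\<integral>x. c * (a * (\<phi> x / X) + (1 - a) * (\<sigma> x / Y)) \<partial>M)"
    proof (rule integral_mono)
      fix x
      have "?h x = c * ((\<phi> x / X) powr a * (\<sigma> x / Y) powr (1 - a))"
        using \<phi> \<sigma> pos by (simp add: c_def powr_divide)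
      also have "\<dots> \<le> c * (a * (\<phi> x / X) + (1 - a) * (\<sigma> x / Y))"
        using \<phi> \<sigma> pos a c by (intro mult_left_mono powr_mult_powr_le_add) auto
      finally show "?h x \<le> c * (a * (\<phi> x / X) + (1 - a) * (\<sigma> x / Y))" .
    qed (use int \<phi> \<sigma> in auto)
    also have "\<dots> = c"
      using \<phi> \<sigma> pos by (simp add: X_def[symmetric] Y_def[symmetric])
    finally show ?thesis by (simp add: c_def)
  qed
qed

text \<open>Hoelder for the counting measure; the absolute values in the instance supply
  nonnegativity outside \<open>I\<close>.\<close>

lemma sum_powr_mult_powr:
  fixes x y :: "'a \<Rightarrow> real"
  assumes "finite I" and "\<And>i. i \<in> I \<Longrightarrow> 0 \<le> x i" "\<And>i. i \<in> I \<Longrightarrow> 0 \<le> y i" and "0 < a" "a < 1"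
  shows "(\<Sum>i\<in>I. x i powr a * y i powr (1 - a)) \<le> (\<Sum>i\<in>I. x i) powr a * (\<Sum>i\<in>I. y i) powr (1 - a)"
  using integral_powr_mult_powr(2)[of "count_space I" "\<lambda>i. \<bar>x i\<bar>" "\<lambda>i. \<bar>y i\<bar>" a] assms
  by (simp add: integrable_count_space lebesgue_integral_count_space_finite)

text \<open>Injectivity makes the exponents distinct nonnegative integers, so the sum is part of the
  full geometric series. It serves for sums over levels.\<close>

lemma sum_geometric_le:
  fixes J :: "int set" and \<rho> :: real
  assumes "finite J" "\<And>j. j \<in> J \<Longrightarrow> 0 \<le> f j" "inj_on f J" "0 < \<rho>" "\<rho> < 1"
  shows "(\<Sum>j\<in>J. \<rho> powr real_of_int (f j)) \<le> 1 / (1 - \<rho>)"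
proof -
  have "(\<Sum>j\<in>J. \<rho> powr real_of_int (f j)) = (\<Sum>j\<in>J. \<rho> ^ nat (f j))"
    using assms by (intro sum.cong) (auto simp: powr_realpow[symmetric])
  also have "\<dots> = (\<Sum>n\<in>(\<lambda>j. nat (f j)) ` J. \<rho> ^ n)"
    using assms(2,3) by (subst sum.reindex) (auto simp: inj_on_def, metis nat_eq_iff2)
  also have "\<dots> \<le> (\<Sum>n. \<rho> ^ n)"
    using assms by (intro sum_le_suminf summable_geometric) auto
  also have "\<dots> = 1 / (1 - \<rho>)" using assms by (intro suminf_geometric) auto
  finally show ?thesis .
qed

lemma discrete_hardy:
  fixes X Y s v w :: "nat \<Rightarrow> real"
  assumes ab: "0 < b" "b \<le> a" "a < 1"
    and nonneg: "\<And>k. 0 \<le> X k" "\<And>k. 0 \<le> Y k" "\<And>k. 0 \<le> s k" "\<And>k. 0 \<le> v k" "\<And>k. 0 \<le> w k"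
    and X1: "(\<Sum>k<N. X k) \<le> 1" and Y1: "(\<Sum>k<N. Y k) \<le> 1" and K: "0 \<le> K"
    and tail: "\<And>r. r < N \<Longrightarrow>
      (\<Sum>k\<le>r. w k powr (1 / (1 - a)) * s k) powr (1 - a) * (\<Sum>l=r..<N. v l) powr b \<le> K"
  shows "(\<Sum>l<N. \<Sum>k\<le>l. w k * (X k powr a * s k powr (1 - a)) * (Y l powr (1 - b) * v l powr b))
    \<le> 2 * 2 powr b / (1 - 2 powr (- b)) * K"
proof -
  \<comment> \<open>Group the indices by the integer part of \<open>- log 2 (V k)\<close>. On a block the tail condition is used at the
    last index, and blocks at distance \<open>d\<close> interact with a factor \<open>2\<^bsup>-bd\<^esup>\<close>.\<close>
  define V where "V r = (\<Sum>l=r..<N. v l)" for r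
  define L where "L = {l. l < N \<and> 0 < V l}"
  define m where "m k = \<lfloor>- log 2 (V k)\<rfloor>" for k
  define J where "J = m ` L"
  define \<alpha> where "\<alpha> k = w k * (X k powr a * s k powr (1 - a))" for k
  define \<beta> where "\<beta> l = Y l powr (1 - b) * v l powr b" for l
  define A where "A i = (\<Sum>k\<in>{k\<in>L. m k = i}. \<alpha> k)" for i
  define B where "B j = (\<Sum>l\<in>{l\<in>L. m l = j}. \<beta> l)" for j
  define XX where "XX i = (\<Sum>k\<in>{k\<in>L. m k = i}. X k)" for i
  define YY where "YY i = (\<Sum>k\<in>{k\<in>L. m k = i}. Y k)" for i
  have finL: "finite L" and LN: "L \<subseteq> {..<N}" by (auto simp: L_def)
  have finJ: "finite J" using finL by (simp add: J_def)
  have \<alpha>0: "0 \<le> \<alpha> k" and \<beta>0: "0 \<le> \<beta> k" for k using nonneg by (auto simp: \<alpha>_def \<beta>_def)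
  have Vmono: "V l \<le> V k" if "k \<le> l" for k l
    unfolding V_def using that nonneg by (intro sum_mono2) auto
  have up: "V k \<le> 2 powr (- real_of_int (m k))" if "k \<in> L" for k
  proof -
    have "V k = 2 powr (log 2 (V k))" using that by (simp add: L_def)
    also have "\<dots> \<le> 2 powr (- real_of_int (m k))" unfolding m_def by (intro powr_mono) linarith+
    finally show ?thesis .
  qed
  have lo: "2 powr (- real_of_int (m k) - 1) \<le> V k" if "k \<in> L" for k
  proof -
    have "2 powr (- real_of_int (m k) - 1) \<le> 2 powr (log 2 (V k))"
      unfolding m_def by (intro powr_mono) linarith+
    also have "\<dots> = V k" using that by (simp add: L_def)
    finally show ?thesis .
  qed
  have Abound: "A i \<le> XX i powr a * (K * 2 powr (b * (real_of_int i + 1)))" if "i \<in> J" for i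
  proof -
    let ?I = "{k\<in>L. m k = i}"
    have I: "finite ?I" "?I \<noteq> {}" using that finL by (auto simp: J_def)
    define r where "r = Max ?I"
    have r: "r \<in> L" "m r = i" and kr: "\<And>k. k \<in> ?I \<Longrightarrow> k \<le> r"
      using Max_in[OF I] I by (auto simp: r_def)
    have "A i = (\<Sum>k\<in>?I. X k powr a * (w k powr (1 / (1 - a)) * s k) powr (1 - a))"
      unfolding A_def \<alpha>_def using nonneg ab
      by (intro sum.cong) (auto simp: powr_mult powr_powr)
    also have "\<dots> \<le> XX i powr a * (\<Sum>k\<in>?I. w k powr (1 / (1 - a)) * s k) powr (1 - a)"
      unfolding XX_def using I nonneg ab by (intro sum_powr_mult_powr) auto
    also have "\<dots> \<le> XX i powr a * (K * 2 powr (b * (real_of_int i + 1)))"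
    proof (rule mult_left_mono)
      define W where "W = (\<Sum>k\<le>r. w k powr (1 / (1 - a)) * s k)"
      have "(\<Sum>k\<in>?I. w k powr (1 / (1 - a)) * s k) \<le> W"
        unfolding W_def using kr nonneg by (intro sum_mono2) auto
      then have "(\<Sum>k\<in>?I. w k powr (1 / (1 - a)) * s k) powr (1 - a) \<le> W powr (1 - a)"
        using ab nonneg by (intro powr_mono2) (auto intro!: sum_nonneg)
      also have "W powr (1 - a) * 2 powr (- (b * (real_of_int i + 1))) \<le> K"
      proof -
        have "2 powr (- (b * (real_of_int i + 1))) = (2 powr (- real_of_int i - 1)) powr b"
          unfolding powr_powr by (rule arg_cong[where f = "\<lambda>x. 2 powr x"]) (simp add: algebra_simps)
        also have "\<dots> \<le> V r powr b" using lo[OF r(1)] r(2) ab by (intro powr_mono2) auto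
        finally have "W powr (1 - a) * 2 powr (- (b * (real_of_int i + 1))) \<le> W powr (1 - a) * V r powr b"
          by (intro mult_left_mono) auto
        also have "\<dots> \<le> K" using tail[of r] r by (simp add: W_def V_def L_def)
        finally show ?thesis .
      qed
      then have "W powr (1 - a) \<le> K * 2 powr (b * (real_of_int i + 1))"
        unfolding powr_minus divide_inverse[symmetric]
        by (subst (asm) pos_divide_le_eq) (auto simp: mult.commute)
      finally show "(\<Sum>k\<in>?I. w k powr (1 / (1 - a)) * s k) powr (1 - a) \<le> K * 2 powr (b * (real_of_int i + 1))" .
    qed simp
    finally show ?thesis .
  qed
  \<comment> \<open>Here the first index \<open>r\<close> of the block is the useful one: the whole
    \<open>v\<close>-mass of the block is part of \<open>V r\<close>.\<close>
  have Bbound: "B j \<le> YY j powr (1 - b) * 2 powr (- (b * real_of_int j))" if "j \<in> J" for j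
  proof -
    let ?I = "{k\<in>L. m k = j}"
    have I: "finite ?I" "?I \<noteq> {}" using that finL by (auto simp: J_def)
    define r where "r = Min ?I"
    have r: "r \<in> L" "m r = j" and kr: "\<And>k. k \<in> ?I \<Longrightarrow> r \<le> k"
      using Min_in[OF I] I by (auto simp: r_def)
    have "B j \<le> YY j powr (1 - b) * (\<Sum>l\<in>?I. v l) powr b"
      unfolding B_def \<beta>_def YY_def using sum_powr_mult_powr[OF I(1), of Y v "1 - b"] nonneg ab by simp
    also have "\<dots> \<le> YY j powr (1 - b) * V r powr b"
    proof (intro mult_left_mono powr_mono2)
      show "(\<Sum>l\<in>?I. v l) \<le> V r"
        unfolding V_def using kr nonneg LN by (intro sum_mono2) auto
    qed (use ab nonneg in \<open>auto intro!: sum_nonneg\<close>)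
    also have "\<dots> \<le> YY j powr (1 - b) * (2 powr (- real_of_int j)) powr b"
      using up[OF r(1)] r ab by (intro mult_left_mono powr_mono2) (auto simp: L_def)
    finally show ?thesis by (simp add: powr_powr mult.commute)
  qed
  have XX0: "0 \<le> XX i" and YY0: "0 \<le> YY i" for i
    using nonneg by (auto simp: XX_def YY_def intro!: sum_nonneg)
  have sumX: "(\<Sum>i\<in>J. XX i) \<le> 1" and sumY: "(\<Sum>i\<in>J. YY i) \<le> 1"
  proof -
    have "(\<Sum>i\<in>J. XX i) = (\<Sum>k\<in>L. X k)"
      unfolding XX_def J_def using finL by (intro sum.group) auto
    also have "\<dots> \<le> (\<Sum>k<N. X k)" using LN nonneg by (intro sum_mono2) auto
    finally show "(\<Sum>i\<in>J. XX i) \<le> 1" using X1 by simp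
    have "(\<Sum>i\<in>J. YY i) = (\<Sum>k\<in>L. Y k)"
      unfolding YY_def J_def using finL by (intro sum.group) auto
    also have "\<dots> \<le> (\<Sum>k<N. Y k)" using LN nonneg by (intro sum_mono2) auto
    finally show "(\<Sum>i\<in>J. YY i) \<le> 1" using Y1 by simp
  qed
  have YY1: "YY i \<le> 1" if "i \<in> J" for i
    using member_le_sum[OF that, of YY] YY0 finJ sumY by force
  define \<rho> where "\<rho> = (2::real) powr (- b)"
  have \<rho>: "0 < \<rho>" "\<rho> < 1" using ab by (auto simp: \<rho>_def powr_less_one)
  have AB: "A i * B j \<le> K * 2 powr b * ((XX i + YY j) * \<rho> powr real_of_int (j - i))"
    if "i \<in> J" "j \<in> J" for i j
  proof -
    have A0: "0 \<le> B j" unfolding B_def using \<beta>0 by (intro sum_nonneg) auto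
    have "A i * B j \<le> (XX i powr a * (K * 2 powr (b * (real_of_int i + 1)))) * (YY j powr (1 - b) * 2 powr (- (b * real_of_int j)))"
      using Abound[OF that(1)] Bbound[OF that(2)] A0 K by (intro mult_mono) auto
    also have "\<dots> = K * 2 powr b * ((XX i powr a * YY j powr (1 - b)) * \<rho> powr real_of_int (j - i))"
    proof -
      have "2 powr (b * (real_of_int i + 1)) * 2 powr (- (b * real_of_int j)) = 2 powr b * \<rho> powr real_of_int (j - i)"
        unfolding \<rho>_def powr_powr powr_add[symmetric]
        by (rule arg_cong[where f = "\<lambda>x. 2 powr x"]) (simp add: algebra_simps)
      then show ?thesis by (simp only: mult.assoc mult.left_commute)
    qed
    also have "\<dots> \<le> K * 2 powr b * ((XX i + YY j) * \<rho> powr real_of_int (j - i))"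
    proof (intro mult_left_mono mult_right_mono)
      \<comment> \<open>As \<open>YY j \<le> 1\<close> and \<open>b \<le> a\<close>, the exponent
        \<open>1 - b\<close> may be lowered to \<open>1 - a\<close>. The exponents then add up to 1,
        and the product is bounded by a sum whose totals over the blocks are known.\<close>
      have "XX i powr a * YY j powr (1 - b) \<le> XX i powr a * YY j powr (1 - a)"
        using YY0[of j] YY1[OF that(2)] ab by (intro mult_left_mono powr_mono') auto
      also have "\<dots> \<le> a * XX i + (1 - a) * YY j"
        using XX0 YY0 ab by (intro powr_mult_powr_le_add) auto
      also have "\<dots> \<le> 1 * XX i + 1 * YY j"
        using XX0 YY0 ab by (intro add_mono mult_right_mono) auto
      finally show "XX i powr a * YY j powr (1 - b) \<le> XX i + YY j" by simp
    qed (use K in auto)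
    finally show ?thesis .
  qed
  \<comment> \<open>Where \<open>V l\<close> vanishes, so does \<open>v l\<close>, and the term
    drops out; on \<open>L\<close> the number \<open>log 2 (V l)\<close> is a true
    logarithm.\<close>
  have "(\<Sum>l<N. \<Sum>k\<le>l. \<alpha> k * \<beta> l) = (\<Sum>l\<in>L. \<Sum>k\<le>l. \<alpha> k * \<beta> l)"
  proof (rule sum.mono_neutral_right)
    show "\<forall>l\<in>{..<N} - L. (\<Sum>k\<le>l. \<alpha> k * \<beta> l) = 0"
    proof
      fix l assume l: "l \<in> {..<N} - L"
      then have "v l \<le> V l" unfolding V_def using nonneg by (intro member_le_sum) auto
      with l nonneg(4)[of l] have "v l = 0" by (auto simp: L_def)
      then show "(\<Sum>k\<le>l. \<alpha> k * \<beta> l) = 0" by (simp add: \<beta>_def)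
    qed
  qed (use LN in auto)
  \<comment> \<open>\<open>V\<close> is antitone, so \<open>k \<le> l\<close> implies
    \<open>m k \<le> m l\<close>. The larger set of pairs is a union of products of blocks.\<close>
  also have "\<dots> \<le> (\<Sum>l\<in>L. (\<Sum>k\<in>{k\<in>L. m k \<le> m l}. \<alpha> k * \<beta> l))"
  proof (intro sum_mono sum_mono2)
    fix l assume l: "l \<in> L"
    show "{..l} \<subseteq> {k\<in>L. m k \<le> m l}"
    proof
      fix k assume "k \<in> {..l}"
      then have "k < N" and V: "V l \<le> V k" "0 < V l" using l Vmono by (auto simp: L_def)
      then show "k \<in> {k\<in>L. m k \<le> m l}" by (auto simp: L_def m_def intro!: floor_mono)
    qed
  qed (use finL \<alpha>0 \<beta>0 in auto)
  also have "\<dots> = (\<Sum>l\<in>L. (\<Sum>i\<in>{i\<in>J. i \<le> m l}. A i) * \<beta> l)"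
  proof (rule sum.cong)
    fix l
    have "(\<Sum>i\<in>{i\<in>J. i \<le> m l}. A i) = (\<Sum>i\<in>{i\<in>J. i \<le> m l}. \<Sum>k\<in>{k\<in>{k\<in>L. m k \<le> m l}. m k = i}. \<alpha> k)"
      unfolding A_def by (intro sum.cong) auto
    also have "\<dots> = (\<Sum>k\<in>{k\<in>L. m k \<le> m l}. \<alpha> k)"
      using finL finJ by (intro sum.group) (auto simp: J_def)
    finally show "(\<Sum>k\<in>{k\<in>L. m k \<le> m l}. \<alpha> k * \<beta> l) = (\<Sum>i\<in>{i\<in>J. i \<le> m l}. A i) * \<beta> l"
      by (simp add: sum_distrib_right)
  qed simp
  also have "\<dots> = (\<Sum>j\<in>J. \<Sum>l\<in>{l\<in>L. m l = j}. (\<Sum>i\<in>{i\<in>J. i \<le> m l}. A i) * \<beta> l)"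
    using finL finJ by (intro sum.group[symmetric]) (auto simp: J_def)
  also have "\<dots> = (\<Sum>j\<in>J. \<Sum>i\<in>{i\<in>J. i \<le> j}. A i * B j)"
  proof (rule sum.cong)
    fix j
    have "(\<Sum>l\<in>{l\<in>L. m l = j}. (\<Sum>i\<in>{i\<in>J. i \<le> m l}. A i) * \<beta> l) = (\<Sum>i\<in>{i\<in>J. i \<le> j}. A i) * B j"
      unfolding B_def sum_distrib_left by (intro sum.cong) auto
    then show "(\<Sum>l\<in>{l\<in>L. m l = j}. (\<Sum>i\<in>{i\<in>J. i \<le> m l}. A i) * \<beta> l) = (\<Sum>i\<in>{i\<in>J. i \<le> j}. A i * B j)"
      by (simp add: sum_distrib_right)
  qed simp
  also have "\<dots> \<le> (\<Sum>j\<in>J. \<Sum>i\<in>{i\<in>J. i \<le> j}. K * 2 powr b * ((XX i + YY j) * \<rho> powr real_of_int (j - i)))"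
    by (intro sum_mono AB) auto
  also have "\<dots> = K * 2 powr b * ((\<Sum>j\<in>J. \<Sum>i\<in>{i\<in>J. i \<le> j}. XX i * \<rho> powr real_of_int (j - i)) +
      (\<Sum>j\<in>J. \<Sum>i\<in>{i\<in>J. i \<le> j}. YY j * \<rho> powr real_of_int (j - i)))"
    by (simp add: sum_distrib_left sum.distrib[symmetric] algebra_simps)
  also have "\<dots> \<le> K * 2 powr b * (1 / (1 - \<rho>) + 1 / (1 - \<rho>))"
  proof (intro mult_left_mono add_mono)
    have "(\<Sum>j\<in>J. \<Sum>i\<in>{i\<in>J. i \<le> j}. XX i * \<rho> powr real_of_int (j - i)) =
        (\<Sum>i\<in>J. \<Sum>j\<in>{j\<in>J. i \<le> j}. XX i * \<rho> powr real_of_int (j - i))"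
      by (rule sum.swap_restrict[OF finJ finJ])
    also have "\<dots> = (\<Sum>i\<in>J. XX i * (\<Sum>j\<in>{j\<in>J. i \<le> j}. \<rho> powr real_of_int (j - i)))"
      by (simp add: sum_distrib_left)
    also have "\<dots> \<le> (\<Sum>i\<in>J. XX i * (1 / (1 - \<rho>)))"
      using finJ \<rho> XX0 by (intro sum_mono mult_left_mono sum_geometric_le) (auto simp: inj_on_def)
    also have "\<dots> \<le> 1 * (1 / (1 - \<rho>))"
      unfolding sum_distrib_right[symmetric] using sumX \<rho> by (intro mult_right_mono) auto
    finally show "(\<Sum>j\<in>J. \<Sum>i\<in>{i\<in>J. i \<le> j}. XX i * \<rho> powr real_of_int (j - i)) \<le> 1 / (1 - \<rho>)" by simp
    have "(\<Sum>j\<in>J. \<Sum>i\<in>{i\<in>J. i \<le> j}. YY j * \<rho> powr real_of_int (j - i)) =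
        (\<Sum>j\<in>J. YY j * (\<Sum>i\<in>{i\<in>J. i \<le> j}. \<rho> powr real_of_int (j - i)))"
      by (simp add: sum_distrib_left)
    also have "\<dots> \<le> (\<Sum>i\<in>J. YY i * (1 / (1 - \<rho>)))"
      using finJ \<rho> YY0 by (intro sum_mono mult_left_mono sum_geometric_le) (auto simp: inj_on_def)
    also have "\<dots> \<le> 1 * (1 / (1 - \<rho>))"
      unfolding sum_distrib_right[symmetric] using sumY \<rho> by (intro mult_right_mono) auto
    finally show "(\<Sum>j\<in>J. \<Sum>i\<in>{i\<in>J. i \<le> j}. YY j * \<rho> powr real_of_int (j - i)) \<le> 1 / (1 - \<rho>)" by simp
  qed (use K in auto)
  also have "\<dots> = 2 * 2 powr b / (1 - 2 powr (- b)) * K" by (simp add: \<rho>_def)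
  finally show ?thesis by (simp add: \<alpha>_def \<beta>_def mult.assoc)
qed

section \<open>The bilinear sum along a chain\<close>

lemma sum_triangle_swap:
  fixes g :: "nat \<Rightarrow> nat \<Rightarrow> 'b::comm_monoid_add"
  shows "(\<Sum>j<N. \<Sum>l=j..<N. g j l) = (\<Sum>l<N. \<Sum>j\<le>l. g j l)"
proof -
  have "(\<Sum>j<N. \<Sum>l=j..<N. g j l) = (\<Sum>j<N. \<Sum>l\<in>{l\<in>{..<N}. j \<le> l}. g j l)"
    by (intro sum.cong) auto
  also have "\<dots> = (\<Sum>l<N. \<Sum>j\<in>{j\<in>{..<N}. j \<le> l}. g j l)"
    by (rule sum.swap_restrict) auto
  also have "\<dots> = (\<Sum>l<N. \<Sum>j\<le>l. g j l)"
    by (intro sum.cong) auto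
  finally show ?thesis .
qed

text \<open>After the sums are exchanged, a pair \<open>k \<le> l\<close> collects all
  \<open>w j\<close> with \<open>j \<le> k\<close>, a geometric sum dominated by its last term. Thus
  only the smallest set of the chain that contains both rings counts.\<close>

lemma sum_triangle_growth_le:
  fixes w \<mu> \<nu> :: "nat \<Rightarrow> real"
  assumes \<rho>: "0 < \<rho>" "\<rho> < 1" and nonneg: "\<And>k. 0 \<le> \<mu> k" "\<And>k. 0 \<le> \<nu> k" "\<And>k. 0 \<le> w k"
    and growth: "\<And>j k. j \<le> k \<Longrightarrow> k < N \<Longrightarrow> w j \<le> \<rho> ^ (k - j) * w k"
  shows "(\<Sum>j<N. w j * (\<Sum>l=j..<N. \<Sum>k=j..l. \<mu> k * \<nu> l))
    \<le> 1 / (1 - \<rho>) * (\<Sum>l<N. \<Sum>k\<le>l. w k * \<mu> k * \<nu> l)"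
proof -
  have ws: "(\<Sum>j\<le>k. w j) \<le> 1 / (1 - \<rho>) * w k" if "k < N" for k
  proof -
    have "(\<Sum>j\<le>k. w j) \<le> (\<Sum>j\<le>k. \<rho> ^ (k - j) * w k)"
      using that by (intro sum_mono growth) auto
    also have "\<dots> = (\<Sum>j\<le>k. \<rho> ^ j) * w k"
      unfolding sum_distrib_right by (rule sum.nat_diff_reindex[of "\<lambda>j. \<rho> ^ j * w k" "Suc k", unfolded lessThan_Suc_atMost, simplified])
    also have "\<dots> \<le> (\<Sum>j. \<rho> ^ j) * w k"
      using \<rho> nonneg by (intro mult_right_mono sum_le_suminf summable_geometric) auto
    also have "(\<Sum>j. \<rho> ^ j) = 1 / (1 - \<rho>)" using \<rho> by (intro suminf_geometric) auto
    finally show ?thesis .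
  qed
  have "(\<Sum>j<N. w j * (\<Sum>l=j..<N. \<Sum>k=j..l. \<mu> k * \<nu> l)) = (\<Sum>j<N. \<Sum>l=j..<N. w j * (\<Sum>k=j..l. \<mu> k * \<nu> l))"
    by (simp add: sum_distrib_left)
  also have "\<dots> = (\<Sum>l<N. \<Sum>j\<le>l. w j * (\<Sum>k=j..l. \<mu> k * \<nu> l))"
    by (rule sum_triangle_swap)
  also have "\<dots> = (\<Sum>l<N. \<Sum>j<Suc l. \<Sum>k=j..<Suc l. w j * (\<mu> k * \<nu> l))"
    by (intro sum.cong) (auto simp: sum_distrib_left lessThan_Suc_atMost atLeastLessThanSuc_atLeastAtMost)
  also have "\<dots> = (\<Sum>l<N. \<Sum>k\<le>l. \<Sum>j\<le>k. w j * (\<mu> k * \<nu> l))"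
    unfolding sum_triangle_swap by (simp add: lessThan_Suc_atMost)
  also have "\<dots> = (\<Sum>l<N. \<Sum>k\<le>l. (\<Sum>j\<le>k. w j) * (\<mu> k * \<nu> l))"
    by (simp add: sum_distrib_right)
  also have "\<dots> \<le> (\<Sum>l<N. \<Sum>k\<le>l. (1 / (1 - \<rho>) * w k) * (\<mu> k * \<nu> l))"
    using nonneg by (intro sum_mono mult_right_mono ws) auto
  also have "\<dots> = 1 / (1 - \<rho>) * (\<Sum>l<N. \<Sum>k\<le>l. w k * \<mu> k * \<nu> l)"
    by (simp add: sum_distrib_left mult.assoc)
  finally show ?thesis .
qed

text \<open>One Hardy constant for each order of the two indices, times the factor from the
  geometric growth of \<open>w\<close>.\<close>

definition chain_const :: "real \<Rightarrow> real \<Rightarrow> real \<Rightarrow> real" where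
  "chain_const a b \<rho> = 1 / (1 - \<rho>) *
    (2 * 2 powr b / (1 - 2 powr (- b)) + 2 * 2 powr (1 - a) / (1 - 2 powr (- (1 - a))))"

lemma chain_sum_le:
  fixes X Y s v w \<mu> \<nu> :: "nat \<Rightarrow> real"
  assumes ab: "0 < b" "b \<le> a" "a < 1" and \<rho>: "0 < \<rho>" "\<rho> < 1"
    and nonneg: "\<And>k. 0 \<le> X k" "\<And>k. 0 \<le> Y k" "\<And>k. 0 \<le> s k" "\<And>k. 0 \<le> v k" "\<And>k. 0 \<le> w k"
      "\<And>k. 0 \<le> \<mu> k" "\<And>k. 0 \<le> \<nu> k"
    and growth: "\<And>j k. j \<le> k \<Longrightarrow> k < N \<Longrightarrow> w j \<le> \<rho> ^ (k - j) * w k"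
    and X1: "(\<Sum>k<N. X k) \<le> 1" and Y1: "(\<Sum>k<N. Y k) \<le> 1" and K: "0 \<le> K"
    and \<mu>: "\<And>k. \<mu> k \<le> X k powr a * s k powr (1 - a)"
    and \<nu>: "\<And>k. \<nu> k \<le> Y k powr (1 - b) * v k powr b"
    and tail1: "\<And>r. r < N \<Longrightarrow>
      (\<Sum>k\<le>r. w k powr (1 / (1 - a)) * s k) powr (1 - a) * (\<Sum>l=r..<N. v l) powr b \<le> K"
    and tail2: "\<And>r. r < N \<Longrightarrow>
      (\<Sum>k\<le>r. w k powr (1 / b) * v k) powr b * (\<Sum>l=r..<N. s l) powr (1 - a) \<le> K"
  shows "(\<Sum>j<N. w j * (\<Sum>k=j..<N. \<mu> k) * (\<Sum>l=j..<N. \<nu> l)) \<le> chain_const a b \<rho> * K"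
proof -
  \<comment> \<open>The diagonal is counted in both halves, which only enlarges the bound.\<close>
  have split: "(\<Sum>k=j..<N. \<mu> k) * (\<Sum>l=j..<N. \<nu> l) \<le>
      (\<Sum>l=j..<N. \<Sum>k=j..l. \<mu> k * \<nu> l) + (\<Sum>k=j..<N. \<Sum>l=j..k. \<nu> l * \<mu> k)" for j
  proof -
    have "(\<Sum>k=j..<N. \<mu> k) * (\<Sum>l=j..<N. \<nu> l) = (\<Sum>k=j..<N. \<Sum>l=j..<N. \<mu> k * \<nu> l)"
      by (rule sum_product)
    also have "\<dots> \<le> (\<Sum>k=j..<N. \<Sum>l=j..<N. (if k \<le> l then \<mu> k * \<nu> l else 0) + (if l \<le> k then \<nu> l * \<mu> k else 0))"
      using nonneg by (intro sum_mono) (auto simp: mult.commute)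
    also have "\<dots> = (\<Sum>l=j..<N. \<Sum>k=j..<N. if k \<le> l then \<mu> k * \<nu> l else 0) +
        (\<Sum>k=j..<N. \<Sum>l=j..<N. if l \<le> k then \<nu> l * \<mu> k else 0)"
      unfolding sum.distrib by (subst sum.swap) simp
    also have "(\<Sum>l=j..<N. \<Sum>k=j..<N. if k \<le> l then \<mu> k * \<nu> l else 0) = (\<Sum>l=j..<N. \<Sum>k=j..l. \<mu> k * \<nu> l)"
      by (intro sum.cong refl sum.mono_neutral_cong_right) auto
    also have "(\<Sum>k=j..<N. \<Sum>l=j..<N. if l \<le> k then \<nu> l * \<mu> k else 0) = (\<Sum>k=j..<N. \<Sum>l=j..k. \<nu> l * \<mu> k)"
      by (intro sum.cong refl sum.mono_neutral_cong_right) auto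
    finally show ?thesis .
  qed
  have h1: "(\<Sum>l<N. \<Sum>k\<le>l. w k * \<mu> k * \<nu> l) \<le> 2 * 2 powr b / (1 - 2 powr (- b)) * K"
  proof -
    have "(\<Sum>l<N. \<Sum>k\<le>l. w k * \<mu> k * \<nu> l) \<le>
        (\<Sum>l<N. \<Sum>k\<le>l. w k * (X k powr a * s k powr (1 - a)) * (Y l powr (1 - b) * v l powr b))"
      using nonneg \<mu> \<nu> by (intro sum_mono mult_mono) auto
    also have "\<dots> \<le> 2 * 2 powr b / (1 - 2 powr (- b)) * K"
      using assms by (intro discrete_hardy) auto
    finally show ?thesis .
  qed
  \<comment> \<open>The dual Hardy inequality: \<open>discrete_hardy\<close> with
    \<open>1 - b\<close> in place of \<open>a\<close> and \<open>1 - a\<close> in place of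
    \<open>b\<close>, and with the two weights and the two densities exchanged. The order
    \<open>b \<le> a\<close> is preserved by this.\<close>
  have h2: "(\<Sum>k<N. \<Sum>l\<le>k. w l * \<nu> l * \<mu> k) \<le> 2 * 2 powr (1 - a) / (1 - 2 powr (- (1 - a))) * K"
  proof -
    have "(\<Sum>k<N. \<Sum>l\<le>k. w l * \<nu> l * \<mu> k) \<le>
        (\<Sum>k<N. \<Sum>l\<le>k. w l * (Y l powr (1 - b) * v l powr (1 - (1 - b))) * (X k powr (1 - (1 - a)) * s k powr (1 - a)))"
      using nonneg \<mu> \<nu> by (intro sum_mono mult_mono) auto
    also have "\<dots> \<le> 2 * 2 powr (1 - a) / (1 - 2 powr (- (1 - a))) * K"
      using assms by (intro discrete_hardy) auto
    finally show ?thesis .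
  qed
  have "(\<Sum>j<N. w j * (\<Sum>k=j..<N. \<mu> k) * (\<Sum>l=j..<N. \<nu> l)) \<le>
      (\<Sum>j<N. w j * ((\<Sum>l=j..<N. \<Sum>k=j..l. \<mu> k * \<nu> l) + (\<Sum>k=j..<N. \<Sum>l=j..k. \<nu> l * \<mu> k)))"
    unfolding mult.assoc using nonneg split by (intro sum_mono mult_left_mono) auto
  also have "\<dots> = (\<Sum>j<N. w j * (\<Sum>l=j..<N. \<Sum>k=j..l. \<mu> k * \<nu> l)) +
      (\<Sum>j<N. w j * (\<Sum>k=j..<N. \<Sum>l=j..k. \<nu> l * \<mu> k))"
    by (simp add: distrib_left sum.distrib)
  also have "\<dots> \<le> 1 / (1 - \<rho>) * (\<Sum>l<N. \<Sum>k\<le>l. w k * \<mu> k * \<nu> l) + 1 / (1 - \<rho>) * (\<Sum>k<N. \<Sum>l\<le>k. w l * \<nu> l * \<mu> k)"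
    using assms by (intro add_mono sum_triangle_growth_le) auto
  also have "\<dots> \<le> 1 / (1 - \<rho>) * (2 * 2 powr b / (1 - 2 powr (- b)) * K) +
      1 / (1 - \<rho>) * (2 * 2 powr (1 - a) / (1 - 2 powr (- (1 - a))) * K)"
    using \<rho> by (intro add_mono mult_left_mono h1 h2) auto
  also have "\<dots> = chain_const a b \<rho> * K" by (simp add: chain_const_def algebra_simps)
  finally show ?thesis .
qed

subsection \<open>Laminar families of sets\<close>

lemma set_integral_nonneg_mono:
  fixes h :: "'a \<Rightarrow> real"
  assumes "integrable M h" "\<And>x. 0 \<le> h x" "A \<in> sets M" "B \<in> sets M" "A \<subseteq> B"
  shows "(LINT x:A|M. h x) \<le> (LINT x:B|M. h x)"
  unfolding set_lebesgue_integral_def using assms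
  by (intro integral_mono integrable_mult_indicator) (auto simp: indicator_def)

lemma set_integral_le_integral:
  fixes h :: "'a \<Rightarrow> real"
  assumes "integrable M h" "\<And>x. 0 \<le> h x" "A \<in> sets M"
  shows "(LINT x:A|M. h x) \<le> (\<integral>x. h x \<partial>M)"
  unfolding set_lebesgue_integral_def using assms
  by (intro integral_mono integrable_mult_indicator) (auto simp: indicator_def)

lemma set_integral_nonneg':
  fixes h :: "'a \<Rightarrow> real"
  assumes "\<And>x. 0 \<le> h x"
  shows "0 \<le> (LINT x:A|M. h x)"
  unfolding set_lebesgue_integral_def using assms by (intro Bochner_Integration.integral_nonneg) auto

lemma set_integral_powr_mult_powr:
  fixes \<phi> \<sigma> :: "'a \<Rightarrow> real"
  assumes "integrable M \<phi>" "\<And>x. 0 \<le> \<phi> x" "integrable M \<sigma>" "\<And>x. 0 \<le> \<sigma> x"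
    and a: "0 < a" "a < 1" and A: "A \<in> sets M"
  shows "(LINT x:A|M. \<phi> x powr a * \<sigma> x powr (1 - a))
    \<le> (LINT x:A|M. \<phi> x) powr a * (LINT x:A|M. \<sigma> x) powr (1 - a)"
proof -
  have "(LINT x:A|M. \<phi> x powr a * \<sigma> x powr (1 - a)) =
      (\<integral>x. (indicator A x * \<phi> x) powr a * (indicator A x * \<sigma> x) powr (1 - a) \<partial>M)"
    unfolding set_lebesgue_integral_def by (intro Bochner_Integration.integral_cong) (auto simp: indicator_def)
  also have "\<dots> \<le> (\<integral>x. indicator A x * \<phi> x \<partial>M) powr a * (\<integral>x. indicator A x * \<sigma> x \<partial>M) powr (1 - a)"
    using assms by (intro integral_powr_mult_powr) (auto intro!: integrable_real_mult_indicator simp: mult.commute)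
  finally show ?thesis by (simp add: set_lebesgue_integral_def)
qed

lemma set_integral_telescope:
  fixes h :: "'a \<Rightarrow> real"
  assumes h: "integrable M h" and Q: "\<And>k. Q k \<in> sets M" "\<And>k. Q (Suc k) \<subseteq> Q k" "Q N = {}" and "j \<le> N"
  shows "(LINT x:Q j|M. h x) = (\<Sum>k=j..<N. LINT x:(Q k - Q (Suc k))|M. h x)"
  using \<open>j \<le> N\<close>
proof (induction j rule: inc_induct)
  case base
  then show ?case using Q by (simp add: set_lebesgue_integral_def)
next
  case (step k)
  have si: "set_integrable M A h" if "A \<in> sets M" for A
    using h that integrable_mult_indicator unfolding set_integrable_def by blast
  have "Q k = (Q k - Q (Suc k)) \<union> Q (Suc k)" using Q(2)[of k] by auto
  then have "(LINT x:Q k|M. h x) = (LINT x:((Q k - Q (Suc k)) \<union> Q (Suc k))|M. h x)" by simp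
  also have "\<dots> = (LINT x:(Q k - Q (Suc k))|M. h x) + (LINT x:Q (Suc k)|M. h x)"
    using Q by (intro set_integral_Un si) auto
  finally show ?case using step by (simp add: sum.atLeast_Suc_lessThan)
qed

lemma sum_set_integral_disjoint_le:
  fixes h :: "'a \<Rightarrow> real"
  assumes h: "integrable M h" "\<And>x. 0 \<le> h x" and T: "finite T" "T \<subseteq> sets M" "disjoint T"
  shows "(\<Sum>A\<in>T. LINT x:A|M. h x) \<le> (\<integral>x. h x \<partial>M)"
proof -
  have si: "set_integrable M A h" if "A \<in> sets M" for A
    using h(1) that integrable_mult_indicator unfolding set_integrable_def by blast
  have "(\<Sum>A\<in>T. LINT x:A|M. h x) = (LINT x:(\<Union>A\<in>T. A)|M. h x)"
    using T by (intro set_integral_finite_Union[symmetric] si) (auto simp: disjoint_family_on_def disjoint_def)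
  also have "\<dots> \<le> (\<integral>x. h x \<partial>M)"
    using T by (intro set_integral_le_integral h) auto
  finally show ?thesis .
qed

text \<open>The largest member is peeled off by induction. The padding by \<open>{}\<close> makes
  the ring \<open>Q k - Q (Suc k)\<close> at the last index the whole innermost set, so that the
  rings exhaust the chain.\<close>

lemma finite_chain_enum:
  fixes c :: "'a set set"
  assumes "finite c" "\<And>A B. A \<in> c \<Longrightarrow> B \<in> c \<Longrightarrow> A \<subseteq> B \<or> B \<subseteq> A"
  obtains Q :: "nat \<Rightarrow> 'a set" and N where "c = Q ` {..<N}" "inj_on Q {..<N}"
    "\<And>i. Q (Suc i) \<subseteq> Q i" "\<And>i. N \<le> i \<Longrightarrow> Q i = {}"
proof -
  have "\<exists>(Q :: nat \<Rightarrow> 'a set) N. c = Q ` {..<N} \<and> inj_on Q {..<N} \<and> (\<forall>i. Q (Suc i) \<subseteq> Q i) \<and> (\<forall>i\<ge>N. Q i = {})"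
    using assms
  proof (induction c rule: finite_psubset_induct)
    case (psubset c)
    show ?case
    proof (cases "c = {}")
      case True
      then show ?thesis by (intro exI[of _ "\<lambda>_. {}"] exI[of _ 0]) auto
    next
      case False
      then obtain T where T: "T \<in> c" "\<And>A. A \<in> c \<Longrightarrow> T \<subseteq> A \<Longrightarrow> A = T"
        using finite_has_maximal[OF psubset.hyps(1)] by metis
      then have top: "A \<subseteq> T" if "A \<in> c" for A using psubset.prems that by blast
      obtain Q :: "nat \<Rightarrow> 'a set" and N where Q: "c - {T} = Q ` {..<N}" "inj_on Q {..<N}"
          "\<And>i. Q (Suc i) \<subseteq> Q i" "\<And>i. N \<le> i \<Longrightarrow> Q i = {}"
      proof -
        have "c - {T} \<subset> c" using T(1) by auto
        moreover have "A \<subseteq> B \<or> B \<subseteq> A" if "A \<in> c - {T}" "B \<in> c - {T}" for A B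
          using psubset.prems that by blast
        ultimately have "\<exists>(Q :: nat \<Rightarrow> 'a set) N. c - {T} = Q ` {..<N} \<and> inj_on Q {..<N} \<and>
            (\<forall>i. Q (Suc i) \<subseteq> Q i) \<and> (\<forall>i\<ge>N. Q i = {})"
          by (rule psubset.IH)
        then show ?thesis using that by metis
      qed
      define Q' where "Q' = case_nat T Q"
      have "c = insert T (c - {T})" using T(1) by auto
      also have "\<dots> = Q' ` {..<Suc N}"
        unfolding lessThan_Suc_eq_insert_0 by (simp add: Q(1) Q'_def image_image)
      finally have 1: "c = Q' ` {..<Suc N}" .
      have "T \<notin> Q ` {..<N}" using Q(1) by (metis Diff_iff singletonI)
      then have 2: "inj_on Q' {..<Suc N}"
        using Q(2) unfolding lessThan_Suc_eq_insert_0 by (auto simp: Q'_def inj_on_def)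
      have 3: "Q' (Suc i) \<subseteq> Q' i" for i
      proof (cases i)
        case 0
        have "Q 0 \<subseteq> T"
        proof (cases N)
          case (Suc n)
          then have "Q 0 \<in> c - {T}" unfolding Q(1) by auto
          then show ?thesis using top by auto
        qed (use Q(4) in auto)
        then show ?thesis by (simp add: 0 Q'_def)
      qed (use Q(3) in \<open>simp add: Q'_def\<close>)
      have 4: "\<forall>i\<ge>Suc N. Q' i = {}" using Q(4) by (auto simp: Q'_def split: nat.split)
      show ?thesis using 1 2 3 4 by blast
    qed
  qed
  with that show ?thesis by blast
qed

text \<open>Raising to the power \<open>1 / e\<close> makes the left side additive in
  \<open>k\<close>. This turns separate bounds that decay in the distance \<open>r - k\<close> into
  the tail condition of Hardy's inequality.\<close>

lemma tail_sum_powr_le: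
  fixes w s c :: "nat \<Rightarrow> real"
  assumes e: "0 < e" and nonneg: "\<And>k. 0 \<le> w k" "\<And>k. 0 \<le> s k" "0 \<le> U" "0 \<le> K"
    and le: "\<And>k. k \<le> r \<Longrightarrow> w k * s k powr e * U \<le> c (r - k)"
    and c: "(\<Sum>k<Suc r. c k powr (1 / e)) \<le> K powr (1 / e)"
  shows "(\<Sum>k\<le>r. w k powr (1 / e) * s k) powr e * U \<le> K"
proof -
  define W where "W = (\<Sum>k\<le>r. w k powr (1 / e) * s k)"
  have W: "0 \<le> W" using nonneg by (auto simp: W_def intro!: sum_nonneg)
  have "W * U powr (1 / e) = (\<Sum>k\<le>r. (w k * s k powr e * U) powr (1 / e))"
    using nonneg e by (auto simp: W_def sum_distrib_right powr_mult powr_powr intro!: sum.cong)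
  also have "\<dots> \<le> (\<Sum>k\<le>r. c (r - k) powr (1 / e))"
    using nonneg e le by (intro sum_mono powr_mono2) auto
  also have "\<dots> = (\<Sum>k<Suc r. c k powr (1 / e))"
    unfolding lessThan_Suc_atMost
    by (rule sum.nat_diff_reindex[of "\<lambda>j. c j powr (1 / e)" "Suc r", unfolded lessThan_Suc_atMost, simplified])
  finally have "W * U powr (1 / e) \<le> K powr (1 / e)" using c by simp
  then have "(W * U powr (1 / e)) powr e \<le> (K powr (1 / e)) powr e"
    using W e by (intro powr_mono2) auto
  then show ?thesis using W e nonneg by (simp add: powr_mult powr_powr W_def[symmetric])
qed

text \<open>
  Here \<open>a = 1/p\<close> and \<open>b = 1/q\<close>. A function \<open>f\<close> enters through \<open>\<phi> = |f|\<^bsup>p\<^esup> \<sigma>\<close>, for which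
  \<open>\<phi>\<^bsup>a\<^esup> \<sigma>\<^bsup>1-a\<^esup> = |f| \<sigma>\<close>; dually \<open>\<psi> = |g|\<^bsup>q'\<^esup> u\<close> and \<open>\<psi>\<^bsup>1-b\<^esup> u\<^bsup>b\<^esup> = |g| u\<close>.
\<close>

locale laminar_system =
  fixes M :: "'a measure" and \<sigma> u :: "'a \<Rightarrow> real" and S :: "'a set set" and size :: "'a set \<Rightarrow> real"
    and a b \<kappa> K :: real and c1 c2 :: "nat \<Rightarrow> real"
  assumes ab: "0 < b" "b < a" "a < 1" and \<kappa>: "0 < \<kappa>" and K: "0 \<le> K"
    and \<sigma>: "integrable M \<sigma>" "\<And>x. 0 \<le> \<sigma> x" and u: "integrable M u" "\<And>x. 0 \<le> u x"
    and S: "finite S" "S \<subseteq> sets M"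
    and laminar: "\<And>A B. A \<in> S \<Longrightarrow> B \<in> S \<Longrightarrow> A \<subseteq> B \<or> B \<subseteq> A \<or> A \<inter> B = {}"
    and size_pos: "\<And>A. A \<in> S \<Longrightarrow> 0 < size A"
    and size_double: "\<And>A B. A \<in> S \<Longrightarrow> B \<in> S \<Longrightarrow> A \<subset> B \<Longrightarrow> 2 * size A \<le> size B"
    and tail1: "\<And>Q R k. Q \<in> S \<Longrightarrow> R \<in> S \<Longrightarrow> R \<subseteq> Q \<Longrightarrow> 2 ^ k * size R \<le> size Q \<Longrightarrow>
      size Q powr (- \<kappa>) * (LINT x:Q|M. \<sigma> x) powr (1 - a) * (LINT x:R|M. u x) powr b \<le> c1 k"
    and tail2: "\<And>Q R k. Q \<in> S \<Longrightarrow> R \<in> S \<Longrightarrow> R \<subseteq> Q \<Longrightarrow> 2 ^ k * size R \<le> size Q \<Longrightarrow>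
      size Q powr (- \<kappa>) * (LINT x:Q|M. u x) powr b * (LINT x:R|M. \<sigma> x) powr (1 - a) \<le> c2 k"
    and c1: "\<And>n. (\<Sum>k<n. c1 k powr (1 / (1 - a))) \<le> K powr (1 / (1 - a))"
    and c2: "\<And>n. (\<Sum>k<n. c2 k powr (1 / b)) \<le> K powr (1 / b)"
begin

text \<open>On the disjoint rings \<open>D k\<close> an integral over \<open>Q j\<close> becomes a
  tail sum, so \<open>chain_sum_le\<close> applies to the masses of the rings. Division by
  \<open>F\<close> and \<open>G\<close> provides its normalisation and is undone at the end.\<close>

lemma chain_bound:
  assumes \<phi>: "integrable M \<phi>" "\<And>x. 0 \<le> \<phi> x" and \<psi>: "integrable M \<psi>" "\<And>x. 0 \<le> \<psi> x"
    and c: "c \<subseteq> S" "\<And>A B. A \<in> c \<Longrightarrow> B \<in> c \<Longrightarrow> A \<subseteq> B \<or> B \<subseteq> A"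
    and F: "0 < F" "\<And>A. A \<in> c \<Longrightarrow> (LINT x:A|M. \<phi> x) \<le> F"
    and G: "0 < G" "\<And>A. A \<in> c \<Longrightarrow> (LINT x:A|M. \<psi> x) \<le> G"
  shows "(\<Sum>Q\<in>c. size Q powr (- \<kappa>) * (LINT x:Q|M. \<phi> x powr a * \<sigma> x powr (1 - a)) *
      (LINT x:Q|M. \<psi> x powr (1 - b) * u x powr b))
    \<le> chain_const a b (2 powr (- \<kappa>)) * K * (F powr a * G powr (1 - b))"
proof -
  obtain Q N where Q: "c = Q ` {..<N}" "inj_on Q {..<N}" "\<And>i. Q (Suc i) \<subseteq> Q i"
      "\<And>i. N \<le> i \<Longrightarrow> Q i = {}"
    using finite_chain_enum[of c] c finite_subset[OF c(1) S(1)] by metis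
  have QS: "Q i \<in> S" if "i < N" for i using c(1) Q(1) that by auto
  have anti: "Q j \<subseteq> Q i" if "i \<le> j" for i j using that Q(3) by (rule lift_Suc_antimono_le[rotated])
  have Qm: "Q i \<in> sets M" for i using QS[of i] S(2) Q(4)[of i] by (cases "i < N") auto
  have strict: "Q (Suc i) \<subset> Q i" if "Suc i < N" for i
    using Q(3)[of i] inj_onD[OF Q(2), of "Suc i" i] that by auto
  \<comment> \<open>Each step of the chain at least halves the size. This gives both the geometric
    growth of \<open>w\<close> and the exponent \<open>k - j\<close> at which the concentration
    bounds are used.\<close>
  have size_iter: "2 ^ (k - j) * size (Q k) \<le> size (Q j)" if "j \<le> k" "k < N" for j k
    using that
  proof (induction k rule: dec_induct)
    case base
    then show ?case by simp
  next
    case (step k)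
    have "2 ^ (Suc k - j) * size (Q (Suc k)) = 2 ^ (k - j) * (2 * size (Q (Suc k)))"
      using step by (simp add: Suc_diff_le)
    also have "\<dots> \<le> 2 ^ (k - j) * size (Q k)"
      using step by (intro mult_left_mono size_double strict QS) auto
    also have "\<dots> \<le> size (Q j)" using step by auto
    finally show ?case .
  qed
  define D where "D k = Q k - Q (Suc k)" for k
  define w where "w k = (if k < N then size (Q k) powr (- \<kappa>) else 0)" for k
  define \<mu> where "\<mu> k = (LINT x:D k|M. \<phi> x powr a * \<sigma> x powr (1 - a)) / F powr a" for k
  define \<nu> where "\<nu> k = (LINT x:D k|M. \<psi> x powr (1 - b) * u x powr b) / G powr (1 - b)" for k
  have Dm: "D k \<in> sets M" for k using Qm by (auto simp: D_def)
  have tele: "(LINT x:Q j|M. h x) = (\<Sum>k=j..<N. LINT x:D k|M. h x)"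
    if "integrable M h" "j \<le> N" for h :: "'a \<Rightarrow> real" and j
    unfolding D_def using that Qm Q by (intro set_integral_telescope) auto
  have i1: "integrable M (\<lambda>x. \<phi> x powr a * \<sigma> x powr (1 - a))"
    using ab by (intro integral_powr_mult_powr \<phi> \<sigma>) auto
  have i2: "integrable M (\<lambda>x. \<psi> x powr (1 - b) * u x powr b)"
    using ab integral_powr_mult_powr(1)[OF \<psi> u, of "1 - b"] by auto
  have "(\<Sum>j<N. w j * (\<Sum>k=j..<N. \<mu> k) * (\<Sum>l=j..<N. \<nu> l)) \<le> chain_const a b (2 powr (- \<kappa>)) * K"
  proof (rule chain_sum_le[where X = "\<lambda>k. (LINT x:D k|M. \<phi> x) / F" and Y = "\<lambda>k. (LINT x:D k|M. \<psi> x) / G"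
        and s = "\<lambda>k. LINT x:D k|M. \<sigma> x" and v = "\<lambda>k. LINT x:D k|M. u x"])
    show "0 < (2::real) powr - \<kappa>" "(2::real) powr - \<kappa> < 1" using \<kappa> by (auto simp: powr_less_one)
    show "\<mu> k \<le> ((LINT x:D k|M. \<phi> x) / F) powr a * (LINT x:D k|M. \<sigma> x) powr (1 - a)" for k
    proof -
      have "((LINT x:D k|M. \<phi> x) / F) powr a * (LINT x:D k|M. \<sigma> x) powr (1 - a) =
          ((LINT x:D k|M. \<phi> x) powr a * (LINT x:D k|M. \<sigma> x) powr (1 - a)) / F powr a"
        using F \<phi> by (simp add: powr_divide set_integral_nonneg')
      then show ?thesis
        unfolding \<mu>_def using ab Dm by (auto intro!: divide_right_mono set_integral_powr_mult_powr \<phi> \<sigma>)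
    qed
    show "\<nu> k \<le> ((LINT x:D k|M. \<psi> x) / G) powr (1 - b) * (LINT x:D k|M. u x) powr b" for k
    proof -
      have "((LINT x:D k|M. \<psi> x) / G) powr (1 - b) * (LINT x:D k|M. u x) powr b =
          ((LINT x:D k|M. \<psi> x) powr (1 - b) * (LINT x:D k|M. u x) powr (1 - (1 - b))) / G powr (1 - b)"
        using G \<psi> by (simp add: powr_divide set_integral_nonneg')
      then show ?thesis
        unfolding \<nu>_def using ab Dm set_integral_powr_mult_powr[OF \<psi> u, of "1 - b" "D k"]
        by (auto intro!: divide_right_mono)
    qed
    show "w j \<le> (2 powr - \<kappa>) ^ (k - j) * w k" if jk: "j \<le> k" "k < N" for j k
    proof -
      have "w j \<le> (2 ^ (k - j) * size (Q k)) powr (- \<kappa>)"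
        using jk size_iter[OF jk] size_pos[OF QS[of k]] \<kappa> by (auto simp: w_def intro!: powr_mono2')
      also have "\<dots> = (2 powr - \<kappa>) ^ (k - j) * w k"
        using jk size_pos[OF QS[of k]]
        by (simp add: w_def powr_mult powr_realpow[symmetric] powr_powr mult.commute)
      finally show ?thesis .
    qed
    show "(\<Sum>k<N. (LINT x:D k|M. \<phi> x) / F) \<le> 1"
    proof (cases "N = 0")
      case False
      then have "(\<Sum>k<N. (LINT x:D k|M. \<phi> x)) \<le> F"
        using tele[OF \<phi>(1), of 0] F(2)[of "Q 0"] Q(1) by (auto simp: atLeast0LessThan)
      then show ?thesis using F by (simp add: sum_divide_distrib[symmetric])
    qed simp
    show "(\<Sum>k<N. (LINT x:D k|M. \<psi> x) / G) \<le> 1"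
    proof (cases "N = 0")
      case False
      then have "(\<Sum>k<N. (LINT x:D k|M. \<psi> x)) \<le> G"
        using tele[OF \<psi>(1), of 0] G(2)[of "Q 0"] Q(1) by (auto simp: atLeast0LessThan)
      then show ?thesis using G by (simp add: sum_divide_distrib[symmetric])
    qed simp
    have Dle: "(LINT x:D k|M. h x) \<le> (LINT x:Q k|M. h x)" if "integrable M h" "\<And>x. 0 \<le> h x"
      for h :: "'a \<Rightarrow> real" and k
      using that Dm Qm by (intro set_integral_nonneg_mono) (auto simp: D_def)
    \<comment> \<open>The rings of \<open>u\<close> from \<open>r\<close> on reassemble to
      \<open>Q r\<close>, and the ring of \<sigma> at \<open>k\<close> is enlarged to
      \<open>Q k\<close>; the concentration bound for \<open>Q r\<close> inside \<open>Q k\<close>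
      then applies.\<close>
    show "(\<Sum>k\<le>r. w k powr (1 / (1 - a)) * (LINT x:D k|M. \<sigma> x)) powr (1 - a) *
        (\<Sum>l=r..<N. LINT x:D l|M. u x) powr b \<le> K" if r: "r < N" for r
    proof (rule tail_sum_powr_le[OF _ _ _ _ K _ c1])
      show "w k * (LINT x:D k|M. \<sigma> x) powr (1 - a) * (\<Sum>l=r..<N. LINT x:D l|M. u x) powr b \<le> c1 (r - k)"
        if "k \<le> r" for k
      proof -
        have "w k * (LINT x:D k|M. \<sigma> x) powr (1 - a) * (LINT x:Q r|M. u x) powr b \<le>
            w k * (LINT x:Q k|M. \<sigma> x) powr (1 - a) * (LINT x:Q r|M. u x) powr b"
          using ab \<sigma> Dle[OF \<sigma>, of k]
          by (intro mult_right_mono mult_left_mono powr_mono2) (auto simp: w_def set_integral_nonneg')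
        also have "\<dots> \<le> c1 (r - k)"
          using that r by (auto simp: w_def intro!: tail1 QS anti size_iter)
        finally show ?thesis using tele[OF u(1), of r] r by simp
      qed
    qed (use ab \<sigma> in \<open>auto simp: w_def set_integral_nonneg'\<close>)
    show "(\<Sum>k\<le>r. w k powr (1 / b) * (LINT x:D k|M. u x)) powr b *
        (\<Sum>l=r..<N. LINT x:D l|M. \<sigma> x) powr (1 - a) \<le> K" if r: "r < N" for r
    proof (rule tail_sum_powr_le[OF _ _ _ _ K _ c2])
      show "w k * (LINT x:D k|M. u x) powr b * (\<Sum>l=r..<N. LINT x:D l|M. \<sigma> x) powr (1 - a) \<le> c2 (r - k)"
        if "k \<le> r" for k
      proof -
        have "w k * (LINT x:D k|M. u x) powr b * (LINT x:Q r|M. \<sigma> x) powr (1 - a) \<le>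
            w k * (LINT x:Q k|M. u x) powr b * (LINT x:Q r|M. \<sigma> x) powr (1 - a)"
          using ab u Dle[OF u, of k]
          by (intro mult_right_mono mult_left_mono powr_mono2) (auto simp: w_def set_integral_nonneg')
        also have "\<dots> \<le> c2 (r - k)"
          using that r by (auto simp: w_def intro!: tail2 QS anti size_iter)
        finally show ?thesis using tele[OF \<sigma>(1), of r] r by simp
      qed
    qed (use ab u in \<open>auto simp: w_def set_integral_nonneg'\<close>)
  qed (use ab K \<phi> \<psi> \<sigma> u F G in \<open>auto simp: w_def \<mu>_def \<nu>_def set_integral_nonneg'\<close>)
  also have "(\<Sum>j<N. w j * (\<Sum>k=j..<N. \<mu> k) * (\<Sum>l=j..<N. \<nu> l)) =
      (\<Sum>j<N. size (Q j) powr (- \<kappa>) * (LINT x:Q j|M. \<phi> x powr a * \<sigma> x powr (1 - a)) *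
      (LINT x:Q j|M. \<psi> x powr (1 - b) * u x powr b)) / (F powr a * G powr (1 - b))"
    unfolding sum_divide_distrib
    by (intro sum.cong) (simp_all add: \<mu>_def \<nu>_def w_def sum_divide_distrib[symmetric] tele[OF i1, symmetric] tele[OF i2, symmetric])
  also have "(\<Sum>j<N. size (Q j) powr (- \<kappa>) * (LINT x:Q j|M. \<phi> x powr a * \<sigma> x powr (1 - a)) *
      (LINT x:Q j|M. \<psi> x powr (1 - b) * u x powr b)) =
    (\<Sum>Q\<in>c. size Q powr (- \<kappa>) * (LINT x:Q|M. \<phi> x powr a * \<sigma> x powr (1 - a)) *
      (LINT x:Q|M. \<psi> x powr (1 - b) * u x powr b))"
    unfolding Q(1) using Q(2) by (simp add: sum.reindex)
  finally show ?thesis using F G by (subst (asm) pos_divide_le_eq) auto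
qed

end

section \<open>Summation over levels of mass\<close>

lemma set_integral_disjoint_add_le:
  fixes h :: "'a \<Rightarrow> real"
  assumes h: "integrable M h" "\<And>x. 0 \<le> h x" and m: "A \<in> sets M" "B \<in> sets M" "T \<in> sets M"
    and sub: "A \<subseteq> T" "B \<subseteq> T" "A \<inter> B = {}"
  shows "(LINT x:A|M. h x) + (LINT x:B|M. h x) \<le> (LINT x:T|M. h x)"
proof -
  have si: "set_integrable M A h" if "A \<in> sets M" for A
    using h(1) that integrable_mult_indicator unfolding set_integrable_def by blast
  have "(LINT x:A|M. h x) + (LINT x:B|M. h x) = (LINT x:(A \<union> B)|M. h x)"
    using m sub by (intro set_integral_Un[symmetric] si) auto
  also have "\<dots> \<le> (LINT x:T|M. h x)"
    using m sub by (intro set_integral_nonneg_mono h) auto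
  finally show ?thesis .
qed

text \<open>The factor 4 is a factor 2 lost within a level times the bound 2 for the total
  normalised mass of disjoint sets. The last factor is the geometric series over all levels from -1
  on.\<close>

definition laminar_const :: "real \<Rightarrow> real \<Rightarrow> real \<Rightarrow> real" where
  "laminar_const a b \<kappa> = chain_const a b (2 powr (- \<kappa>)) * 4 * (2 powr (a - b) / (1 - 2 powr (- (a - b))))"

lemma chain_const_nonneg:
  assumes "0 < b" "a < 1" "\<rho> < 1"
  shows "0 \<le> chain_const a b \<rho>"
  using assms powr_less_one[of 2 "- b"] powr_less_one[of 2 "- (1 - a)"]
  by (auto simp: chain_const_def intro!: mult_nonneg_nonneg add_nonneg_nonneg divide_nonneg_nonneg)

lemma laminar_const_nonneg:
  assumes "0 < b" "b < a" "a < 1" "0 < \<kappa>"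
  shows "0 \<le> laminar_const a b \<kappa>"
proof -
  have "2 powr - \<kappa> < (1::real)" "2 powr (- (a - b)) < (1::real)"
    using assms by (auto intro!: powr_less_one)
  then show ?thesis using assms chain_const_nonneg[of b a "2 powr - \<kappa>"]
    by (auto simp: laminar_const_def)
qed

context laminar_system
begin

lemma bilinear_bound:
  assumes \<phi>: "integrable M \<phi>" "\<And>x. 0 \<le> \<phi> x" and \<psi>: "integrable M \<psi>" "\<And>x. 0 \<le> \<psi> x"
  shows "(\<Sum>Q\<in>S. size Q powr (- \<kappa>) * (LINT x:Q|M. \<phi> x powr a * \<sigma> x powr (1 - a)) *
      (LINT x:Q|M. \<psi> x powr (1 - b) * u x powr b))
    \<le> laminar_const a b \<kappa> * K * ((\<integral>x. \<phi> x \<partial>M) powr a * (\<integral>x. \<psi> x \<partial>M) powr (1 - b))"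
proof -
  define F where "F = (\<integral>x. \<phi> x \<partial>M)"
  define G where "G = (\<integral>x. \<psi> x \<partial>M)"
  define t where "t Q = size Q powr (- \<kappa>) * (LINT x:Q|M. \<phi> x powr a * \<sigma> x powr (1 - a)) *
      (LINT x:Q|M. \<psi> x powr (1 - b) * u x powr b)" for Q
  have FG0: "0 \<le> F" "0 \<le> G" using \<phi> \<psi> by (auto simp: F_def G_def)
  have Sm: "A \<in> sets M" if "A \<in> S" for A using S that by auto
  have \<phi>0: "0 \<le> (LINT x:A|M. \<phi> x)" and \<psi>0: "0 \<le> (LINT x:A|M. \<psi> x)" for A
    using \<phi> \<psi> by (auto intro!: set_integral_nonneg')
  have \<phi>F: "(LINT x:A|M. \<phi> x) \<le> F" and \<psi>G: "(LINT x:A|M. \<psi> x) \<le> G" if "A \<in> S" for A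
    unfolding F_def G_def using that Sm by (auto intro!: set_integral_le_integral \<phi> \<psi>)
  have t0: "0 \<le> t A" for A unfolding t_def by (intro mult_nonneg_nonneg set_integral_nonneg') auto
  \<comment> \<open>By Hoelder a term vanishes as soon as one of its masses does. This settles the
    case of zero total mass, where \<open>H\<close> could not be normalised, and the sets with
    \<open>H A = 0\<close>, which have no level.\<close>
  have tzero: "t A = 0" if "A \<in> S" "(LINT x:A|M. \<phi> x) = 0 \<or> (LINT x:A|M. \<psi> x) = 0" for A
  proof -
    have "(LINT x:A|M. \<phi> x powr a * \<sigma> x powr (1 - a)) \<le> (LINT x:A|M. \<phi> x) powr a * (LINT x:A|M. \<sigma> x) powr (1 - a)"
      using ab Sm that by (intro set_integral_powr_mult_powr \<phi> \<sigma>) auto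
    moreover have "(LINT x:A|M. \<psi> x powr (1 - b) * u x powr b) \<le> (LINT x:A|M. \<psi> x) powr (1 - b) * (LINT x:A|M. u x) powr b"
      using ab Sm that set_integral_powr_mult_powr[OF \<psi> u, of "1 - b" A] by auto
    moreover have "0 \<le> (LINT x:A|M. \<phi> x powr a * \<sigma> x powr (1 - a))" "0 \<le> (LINT x:A|M. \<psi> x powr (1 - b) * u x powr b)"
      by (auto intro!: set_integral_nonneg')
    ultimately show ?thesis using that(2) by (auto simp: t_def)
  qed
  show "(\<Sum>Q\<in>S. t Q) \<le> laminar_const a b \<kappa> * K * (F powr a * G powr (1 - b))"
  proof (cases "F = 0 \<or> G = 0")
    case True
    then have "t A = 0" if "A \<in> S" for A
      using that \<phi>F[OF that] \<psi>G[OF that] \<phi>0[of A] \<psi>0[of A] by (intro tzero) auto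
    then show ?thesis using True by auto
  next
    case False
    with FG0 have FG: "0 < F" "0 < G" by auto
    define H where "H A = (LINT x:A|M. \<phi> x) / F + (LINT x:A|M. \<psi> x) / G" for A
    have H0: "0 \<le> H A" for A using \<phi>0 \<psi>0 FG by (auto simp: H_def)
    have \<phi>H: "(LINT x:A|M. \<phi> x) \<le> F * H A" and \<psi>H: "(LINT x:A|M. \<psi> x) \<le> G * H A" for A
      using \<phi>0[of A] \<psi>0[of A] FG by (auto simp: H_def field_simps)
    have H2: "H A \<le> 2" if "A \<in> S" for A
    proof -
      have "(LINT x:A|M. \<phi> x) / F \<le> 1" "(LINT x:A|M. \<psi> x) / G \<le> 1"
        using \<phi>F[OF that] \<psi>G[OF that] FG by auto
      then show ?thesis by (simp add: H_def)
    qed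
    have Hadd: "H A + H B \<le> H T" if "A \<in> S" "B \<in> S" "T \<in> S" "A \<subseteq> T" "B \<subseteq> T" "A \<inter> B = {}" for A B T
    proof -
      have "((LINT x:A|M. \<phi> x) + (LINT x:B|M. \<phi> x)) / F \<le> (LINT x:T|M. \<phi> x) / F"
        using that Sm FG by (intro divide_right_mono set_integral_disjoint_add_le \<phi>) auto
      moreover have "((LINT x:A|M. \<psi> x) + (LINT x:B|M. \<psi> x)) / G \<le> (LINT x:T|M. \<psi> x) / G"
        using that Sm FG by (intro divide_right_mono set_integral_disjoint_add_le \<psi>) auto
      ultimately show ?thesis by (simp add: H_def add_divide_distrib)
    qed
    define S' where "S' = {A\<in>S. 0 < H A}"
    define lev where "lev A = \<lfloor>- log 2 (H A)\<rfloor>" for A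
    have up: "H A \<le> 2 powr (- real_of_int (lev A))" if "A \<in> S'" for A
    proof -
      have "H A = 2 powr (log 2 (H A))" using that by (simp add: S'_def)
      also have "\<dots> \<le> 2 powr (- real_of_int (lev A))" unfolding lev_def by (intro powr_mono) linarith+
      finally show ?thesis .
    qed
    have lo: "2 powr (- real_of_int (lev A) - 1) < H A" if "A \<in> S'" for A
    proof -
      have "2 powr (- real_of_int (lev A) - 1) < 2 powr (log 2 (H A))"
        unfolding lev_def by (intro powr_less_mono) linarith+
      also have "\<dots> = H A" using that by (simp add: S'_def)
      finally show ?thesis .
    qed
    \<comment> \<open>\<open>H\<close> adds two normalised masses and is thus at most 2, so the
      levels start at -1; hence the shift \<open>i + 1\<close> in the geometric sum.\<close>
    have lev_ge: "- 1 \<le> lev A" if "A \<in> S'" for A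
    proof -
      have "log 2 (H A) \<le> log 2 2" using that H2[of A] by (subst log_le_cancel_iff) (auto simp: S'_def)
      then show ?thesis by (simp add: lev_def le_floor_iff)
    qed
    define J where "J = lev ` S'"
    have finS': "finite S'" using S by (simp add: S'_def)
    have finJ: "finite J" using finS' by (simp add: J_def)
    define CK where "CK = chain_const a b (2 powr (- \<kappa>)) * K * (F powr a * G powr (1 - b))"
    have "chain_const a b (2 powr (- \<kappa>)) \<ge> 0"
      using ab \<kappa> by (intro chain_const_nonneg) (auto simp: powr_less_one)
    then have CK: "0 \<le> CK" using K by (simp add: CK_def)
    have level: "(\<Sum>A\<in>{A\<in>S'. lev A = i}. t A) \<le> CK * 4 * 2 powr (- real_of_int i * (a - b))" for i
    proof -
      define Si where "Si = {A\<in>S'. lev A = i}"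
      define Top where "Top = {T\<in>Si. \<forall>A\<in>Si. T \<subseteq> A \<longrightarrow> A = T}"
      have SiS: "A \<in> S" if "A \<in> Si" for A using that by (auto simp: Si_def S'_def)
      have fin: "finite Si" "finite Top" using finS' by (auto simp: Si_def Top_def)
      have TopSi: "T \<in> Si" if "T \<in> Top" for T using that by (simp add: Top_def)
      have covered: "\<exists>T\<in>Top. A \<subseteq> T" if "A \<in> Si" for A
        using finite_has_maximal2[OF fin(1) that] by (auto simp: Top_def)
      have disj: "disjoint Top"
        unfolding disjoint_def
      proof (intro ballI impI)
        fix A B assume "A \<in> Top" "B \<in> Top" "A \<noteq> B"
        then show "A \<inter> B = {}"
          using laminar[of A B] SiS unfolding Top_def by blast
      qed
      have one: "(\<Sum>A\<in>{A\<in>Si. A \<subseteq> T}. t A) \<le> CK * 2 * 2 powr (- real_of_int i * (a - b)) * H T"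
        if T: "T \<in> Top" for T
      proof -
        have TS: "T \<in> Si" using T TopSi by auto
        have "(\<Sum>A\<in>{A\<in>Si. A \<subseteq> T}. t A) \<le> chain_const a b (2 powr (- \<kappa>)) * K *
            ((F * 2 powr (- real_of_int i)) powr a * (G * 2 powr (- real_of_int i)) powr (1 - b))"
          unfolding t_def
        proof (rule chain_bound[OF \<phi> \<psi>])
          show "{A \<in> Si. A \<subseteq> T} \<subseteq> S" using SiS by auto
          \<comment> \<open>Incomparable sets would be disjoint, and their values of
            \<open>H\<close>, each strictly above half of \<open>2 powr (- i)\<close>, would add up
            to more than \<open>H T\<close> can be.\<close>
          show "A \<subseteq> B \<or> B \<subseteq> A" if "A \<in> {A \<in> Si. A \<subseteq> T}" "B \<in> {A \<in> Si. A \<subseteq> T}" for A B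
          proof (rule ccontr)
            assume "\<not> (A \<subseteq> B \<or> B \<subseteq> A)"
            then have "H A + H B \<le> H T" using that laminar[of A B] SiS TS by (intro Hadd) auto
            moreover have "2 powr (- real_of_int i - 1) < H A" "2 powr (- real_of_int i - 1) < H B"
              using that lo[of A] lo[of B] by (auto simp: Si_def)
            moreover have "H T \<le> 2 powr (- real_of_int i)" using up[of T] TS by (auto simp: Si_def)
            ultimately show False by (simp add: powr_diff)
          qed
          fix A assume "A \<in> {A \<in> Si. A \<subseteq> T}"
          then have *: "H A \<le> 2 powr (- real_of_int i)" using up[of A] by (auto simp: Si_def)
          show "(LINT x:A|M. \<phi> x) \<le> F * 2 powr (- real_of_int i)"
            using \<phi>H[of A] * FG by (meson mult_left_mono order_trans less_imp_le)
          show "(LINT x:A|M. \<psi> x) \<le> G * 2 powr (- real_of_int i)"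
            using \<psi>H[of A] * FG by (meson mult_left_mono order_trans less_imp_le)
        qed (use FG in auto)
        also have "\<dots> = CK * ((2 powr (- real_of_int i)) powr a * (2 powr (- real_of_int i)) powr (1 - b))"
          using FG by (simp add: CK_def powr_mult)
        \<comment> \<open>The exponents add up to 1 + (a - b). One full power is traded for
          \<open>H T\<close>, whose sum over the maximal sets is bounded; the excess a - b > 0 makes
          the levels summable.\<close>
        also have "(2 powr (- real_of_int i)) powr a * (2 powr (- real_of_int i)) powr (1 - b) =
            2 powr (- real_of_int i * (a - b)) * 2 powr (- real_of_int i - 1) * 2 powr 1"
          unfolding powr_powr powr_add[symmetric]
          by (rule arg_cong[where f = "\<lambda>x. 2 powr x"]) (simp add: algebra_simps)
        also have "CK * \<dots> \<le> CK * (2 powr (- real_of_int i * (a - b)) * H T * 2 powr 1)"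
          using lo[of T] TS CK by (intro mult_left_mono mult_right_mono) (auto simp: Si_def)
        finally show ?thesis by (simp add: mult_ac)
      qed
      have HT: "(\<Sum>T\<in>Top. H T) \<le> 2"
      proof -
        have "(\<Sum>T\<in>Top. LINT x:T|M. \<phi> x) \<le> F" "(\<Sum>T\<in>Top. LINT x:T|M. \<psi> x) \<le> G"
          unfolding F_def G_def using fin disj TopSi SiS Sm
          by (auto intro!: sum_set_integral_disjoint_le \<phi> \<psi>)
        then have "(\<Sum>T\<in>Top. LINT x:T|M. \<phi> x) / F \<le> 1" "(\<Sum>T\<in>Top. LINT x:T|M. \<psi> x) / G \<le> 1"
          using FG by auto
        then show ?thesis by (simp add: H_def sum.distrib sum_divide_distrib[symmetric])
      qed
      have "(\<Sum>A\<in>Si. t A) \<le> (\<Sum>A\<in>Si. \<Sum>T\<in>{T\<in>Top. A \<subseteq> T}. t A)"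
      proof (rule sum_mono)
        fix A assume "A \<in> Si"
        then obtain T where "T \<in> {T\<in>Top. A \<subseteq> T}" using covered by auto
        then show "t A \<le> (\<Sum>T\<in>{T\<in>Top. A \<subseteq> T}. t A)"
          using t0 fin by (intro member_le_sum[where f = "\<lambda>_. t A"]) auto
      qed
      also have "\<dots> = (\<Sum>T\<in>Top. \<Sum>A\<in>{A\<in>Si. A \<subseteq> T}. t A)"
        by (rule sum.swap_restrict[OF fin])
      also have "\<dots> \<le> (\<Sum>T\<in>Top. CK * 2 * 2 powr (- real_of_int i * (a - b)) * H T)"
        by (intro sum_mono one)
      also have "\<dots> \<le> CK * 2 * 2 powr (- real_of_int i * (a - b)) * 2"
        unfolding sum_distrib_left[symmetric] using CK HT by (intro mult_left_mono) auto
      finally show ?thesis by (simp add: Si_def mult_ac)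
    qed
    have "(\<Sum>A\<in>S. t A) = (\<Sum>A\<in>S'. t A)"
    proof (rule sum.mono_neutral_right)
      show "\<forall>A\<in>S - S'. t A = 0"
      proof
        fix A assume A: "A \<in> S - S'"
        then have "H A = 0" using H0[of A] by (auto simp: S'_def)
        then have "(LINT x:A|M. \<phi> x) = 0" using \<phi>H[of A] \<phi>0[of A] by simp
        then show "t A = 0" using A by (intro tzero) auto
      qed
    qed (use S in \<open>auto simp: S'_def\<close>)
    also have "\<dots> = (\<Sum>i\<in>J. \<Sum>A\<in>{A\<in>S'. lev A = i}. t A)"
      using finS' finJ by (intro sum.group[symmetric]) (auto simp: J_def)
    also have "\<dots> \<le> (\<Sum>i\<in>J. CK * 4 * 2 powr (- real_of_int i * (a - b)))"
      by (intro sum_mono level)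
    also have "\<dots> = CK * 4 * 2 powr (a - b) * (\<Sum>i\<in>J. (2 powr (- (a - b))) powr real_of_int (i + 1))"
    proof -
      have "2 powr (- real_of_int i * (a - b)) = 2 powr (a - b) * (2 powr (- (a - b))) powr real_of_int (i + 1)" for i
        unfolding powr_powr powr_add[symmetric]
        by (rule arg_cong[where f = "\<lambda>x. 2 powr x"]) (simp add: algebra_simps)
      then show ?thesis by (simp only: sum_distrib_left mult.assoc)
    qed
    also have "\<dots> \<le> CK * 4 * 2 powr (a - b) * (1 / (1 - 2 powr (- (a - b))))"
    proof (intro mult_left_mono sum_geometric_le)
      show "0 \<le> i + 1" if "i \<in> J" for i using lev_ge that by (fastforce simp: J_def)
      show "2 powr (- (a - b)) < (1::real)" using ab by (intro powr_less_one) auto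
    qed (use CK finJ in \<open>auto simp: inj_on_def\<close>)
    finally show ?thesis by (simp add: CK_def laminar_const_def mult_ac)
  qed
qed

text \<open>Testing the bilinear bound against a power of \<open>T\<close> itself gives
  \<open>I \<le> C * I powr (1 - b)\<close>, which is solved for \<open>I\<close>. With
  \<open>1 / b\<close> = q this is the norm inequality for the dyadic operator, raised to the power
  q.\<close>

lemma operator_bound:
  assumes \<phi>: "integrable M \<phi>" "\<And>x. 0 \<le> \<phi> x"
  defines "T \<equiv> \<lambda>x. \<Sum>Q\<in>S. size Q powr (- \<kappa>) * (LINT y:Q|M. \<phi> y powr a * \<sigma> y powr (1 - a)) * indicator Q x"
  shows "integrable M (\<lambda>x. T x powr (1 / b) * u x)"
    and "(\<integral>x. T x powr (1 / b) * u x \<partial>M) \<le> (laminar_const a b \<kappa> * K * (\<integral>x. \<phi> x \<partial>M) powr a) powr (1 / b)"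
proof -
  define m where "m Q = size Q powr (- \<kappa>) * (LINT y:Q|M. \<phi> y powr a * \<sigma> y powr (1 - a))" for Q
  have T: "T x = (\<Sum>Q\<in>S. m Q * indicator Q x)" for x by (simp add: T_def m_def)
  have m0: "0 \<le> m Q" for Q unfolding m_def by (intro mult_nonneg_nonneg set_integral_nonneg') auto
  have T0: "0 \<le> T x" for x unfolding T using m0 by (intro sum_nonneg) auto
  have TB: "T x \<le> (\<Sum>Q\<in>S. m Q)" for x
    unfolding T using m0 by (intro sum_mono) (auto simp: indicator_def)
  have Sm: "Q \<in> sets M" if "Q \<in> S" for Q using S that by auto
  have [measurable]: "u \<in> borel_measurable M" using u by auto
  have [measurable]: "T \<in> borel_measurable M" unfolding T using Sm by measurable
  \<comment> \<open>\<open>T\<close> is a finite sum of multiples of indicators, hence bounded. So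
    \<open>I\<close> is a true finite integral before any estimate, and a power of it may be
    cancelled later.\<close>
  have powint: "integrable M (\<lambda>x. T x powr e * u x)" if "0 < e" for e
  proof (rule Bochner_Integration.integrable_bound)
    show "integrable M (\<lambda>x. (\<Sum>Q\<in>S. m Q) powr e * u x)" using u by auto
    show "AE x in M. norm (T x powr e * u x) \<le> norm ((\<Sum>Q\<in>S. m Q) powr e * u x)"
      using T0 TB u that by (auto intro!: AE_I2 mult_right_mono powr_mono2)
  qed simp
  have e: "0 < 1 / b - 1" using ab by (simp add: field_simps)
  \<comment> \<open>Duality: this is the density \<open>\<psi>\<close> of the test function \<open>g = T\<^bsup>q-1\<^esup>\<close>.\<close>
  define \<psi> where "\<psi> x = T x powr (1 / b) * u x" for x
  show int: "integrable M (\<lambda>x. T x powr (1 / b) * u x)" using powint ab by simp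
  then have \<psi>: "integrable M \<psi>" "\<And>x. 0 \<le> \<psi> x" using u by (auto simp: \<psi>_def[abs_def])
  have \<psi>u: "\<psi> x powr (1 - b) * u x powr b = T x powr (1 / b - 1) * u x" for x
  proof -
    have "\<psi> x powr (1 - b) * u x powr b = T x powr (1 / b - 1) * (u x powr (1 - b) * u x powr b)"
      using ab u by (simp add: \<psi>_def powr_mult powr_powr field_simps)
    also have "u x powr (1 - b) * u x powr b = u x" using u by (simp add: powr_add[symmetric])
    finally show ?thesis .
  qed
  have \<psi>T: "\<psi> x = T x * (T x powr (1 / b - 1) * u x)" for x
    using T0[of x] powr_add[of "T x" 1 "1 / b - 1"] by (simp add: \<psi>_def)
  define I where "I = (\<integral>x. \<psi> x \<partial>M)"
  define C where "C = laminar_const a b \<kappa> * K * (\<integral>x. \<phi> x \<partial>M) powr a"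
  have C: "0 \<le> C" using laminar_const_nonneg[of b a \<kappa>] ab \<kappa> K by (simp add: C_def)
  have Tmult: "T x * y = (\<Sum>Q\<in>S. m Q * (indicator Q x * y))" for x y
    by (simp add: T sum_distrib_right mult.assoc)
  have "I = (\<integral>x. (\<Sum>Q\<in>S. m Q * (indicator Q x * (T x powr (1 / b - 1) * u x))) \<partial>M)"
    unfolding I_def by (intro Bochner_Integration.integral_cong) (simp_all only: \<psi>T Tmult)
  also have "\<dots> = (\<Sum>Q\<in>S. m Q * (LINT x:Q|M. \<psi> x powr (1 - b) * u x powr b))"
    unfolding set_lebesgue_integral_def \<psi>u
    using integrable_real_mult_indicator[OF Sm powint[OF e]]
    by (subst Bochner_Integration.integral_sum) (auto simp: mult.commute)
  also have "\<dots> \<le> C * I powr (1 - b)"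
    using bilinear_bound[OF \<phi> \<psi>] by (simp add: m_def C_def I_def mult_ac)
  finally have main: "I \<le> C * I powr (1 - b)" .
  have I0: "0 \<le> I" unfolding I_def using \<psi> by auto
  have "I \<le> C powr (1 / b)"
  proof (cases "I = 0")
    case False
    with I0 have I: "0 < I" by simp
    have "I powr b * I powr (1 - b) = I" using I by (simp add: powr_add[symmetric])
    with main have "I powr b * I powr (1 - b) \<le> C * I powr (1 - b)" by simp
    then have "I powr b \<le> C" using I by simp
    then have "(I powr b) powr (1 / b) \<le> C powr (1 / b)" using ab by (intro powr_mono2) auto
    then show ?thesis using I ab by (simp add: powr_powr)
  qed simp
  then show "(\<integral>x. T x powr (1 / b) * u x \<partial>M) \<le> (laminar_const a b \<kappa> * K * (\<integral>x. \<phi> x \<partial>M) powr a) powr (1 / b)"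
    by (simp add: I_def C_def \<psi>_def)
qed

end

subsection \<open>Concentration of a weight under a log bump\<close>

lemma weight_nonneg: "weight w \<Longrightarrow> 0 \<le> w x"
  unfolding weight_def by blast

lemma weight_compact: "weight w \<Longrightarrow> compact A \<Longrightarrow> set_integrable lebesgue A w"
  unfolding weight_def by blast

lemma weight_set_integrable:
  assumes "weight w" "bounded A" "A \<in> sets lebesgue"
  shows "set_integrable lebesgue A w"
proof -
  obtain r where r: "A \<subseteq> cball 0 r" using assms(2) unfolding bounded_iff by (auto simp: subset_iff)
  from set_integrable_subset[OF weight_compact[OF assms(1) compact_cball] assms(3) r] show ?thesis .
qed

text \<open>Local integrability speaks of compact sets only; the weight is the pointwise limit of
  its restrictions to balls.\<close>

lemma weight_measurable:
  fixes w :: "real ^ 'n \<Rightarrow> real"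
  assumes "weight w"
  shows "w \<in> borel_measurable lebesgue"
proof (rule borel_measurable_LIMSEQ_real)
  fix x :: "real ^ 'n"
  obtain N :: nat where N: "norm x \<le> real N" using real_arch_simple by blast
  have "\<forall>\<^sub>F n in sequentially. indicat_real (cball 0 (real n)) x * w x = w x"
    using eventually_ge_at_top[of N] by eventually_elim (use N in auto)
  then show "(\<lambda>n. indicat_real (cball 0 (real n)) x * w x) \<longlonglongrightarrow> w x"
    by (rule tendsto_eventually)
next
  fix n
  have "set_integrable lebesgue (cball 0 (real n)) w"
    by (rule weight_compact[OF assms compact_cball])
  then have "integrable lebesgue (\<lambda>x. indicat_real (cball 0 (real n)) x * w x)"
    by (simp add: set_integrable_def)
  then show "(\<lambda>x. indicat_real (cball 0 (real n)) x * w x) \<in> borel_measurable lebesgue"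
    by (rule borel_measurable_integrable)
qed

lemma nn_set_integral_weight:
  assumes "weight w" "bounded A" "A \<in> sets lebesgue"
  shows "(\<integral>\<^sup>+x\<in>A. ennreal (w x) \<partial>lebesgue) = ennreal (LINT x:A|lebesgue. w x)"
proof -
  have "(\<integral>\<^sup>+x\<in>A. ennreal (w x) \<partial>lebesgue) = (\<integral>\<^sup>+x. ennreal (indicator A x * w x) \<partial>lebesgue)"
    by (intro nn_integral_cong) (auto simp: indicator_def)
  also have "\<dots> = ennreal (\<integral>x. indicator A x * w x \<partial>lebesgue)"
    using weight_set_integrable[OF assms] weight_nonneg[OF assms(1)]
    by (intro nn_integral_eq_integral) (auto simp: set_integrable_def)
  finally show ?thesis by (simp add: set_lebesgue_integral_def)
qed

lemma cube_facts:
  fixes Q :: "(real ^ 'n) set"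
  assumes "Q \<in> cubes"
  shows "Q \<in> sets lebesgue" "bounded Q" "0 < measure lebesgue Q"
    "emeasure lebesgue Q = ennreal (measure lebesgue Q)"
proof -
  obtain a and l :: real where Q: "Q = cbox a (a + (\<chi> i. l))" and l: "0 < l"
    using assms by (auto simp: cubes_def)
  show "Q \<in> sets lebesgue" "bounded Q" by (auto simp: Q bounded_cbox)
  have "a \<in> Q" using l by (auto simp: Q mem_box_cart)
  then have "cbox a (a + (\<chi> i. l)) \<noteq> {}" unfolding Q by blast
  from content_cbox_cart[OF this] have "measure lebesgue Q = (\<Prod>i\<in>(UNIV::'n set). l)"
    unfolding Q by (subst measure_completion) simp_all
  then show "0 < measure lebesgue Q" using l by simp
  show "emeasure lebesgue Q = ennreal (measure lebesgue Q)"
    unfolding Q using fmeasurableD2[OF lmeasurable_cbox] by (intro emeasure_eq_ennreal_measure) auto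
qed

text \<open>
  The two terms come from splitting a mean value at the height \<open>2\<^bsup>k/(2r)\<^esup>\<close>: below it the smallness of the
  set is used, above it the logarithm.
\<close>

definition bump_decay :: "real \<Rightarrow> real \<Rightarrow> nat \<Rightarrow> real" where
  "bump_decay r \<eta> k = 2 powr (- real k / 2) + ln (exp 1 + 2 powr (real k / (2 * r))) powr (- \<eta>)"

text \<open>The first term decays exponentially, and in the second the logarithm grows at least
  linearly in \<open>k\<close>.\<close>

lemma bump_decay_le:
  assumes r: "1 \<le> r" and \<eta>: "0 < \<eta>"
  obtains C where "0 < C" "\<And>k. bump_decay r \<eta> k \<le> C * real (k + 1) powr (- \<eta>)"
proof -
  define d where "d = ln 2 / (2 * r)"
  have d: "0 < d" "d \<le> 1" using r ln_2_less_1 by (auto simp: d_def field_simps)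
  \<comment> \<open>Chosen so that \<open>\<eta> * t = ln 2 / 2\<close>: then
    \<open>ln x \<le> x - 1\<close> at \<open>x = (k + 1) * t\<close> compares
    \<open>(k + 1) powr \<eta>\<close> with \<open>2 powr (k / 2)\<close>.\<close>
  define t where "t = ln 2 / (2 * \<eta>)"
  have t: "0 < t" using \<eta> by (simp add: t_def)
  define B where "B = 2 powr (1 / 2) * exp (- \<eta> - \<eta> * ln t)"
  have B: "0 < B" by (simp add: B_def)
  have 1: "2 powr (- real k / 2) \<le> B * real (k + 1) powr (- \<eta>)" for k
  proof -
    have "ln (real (k + 1)) + ln t \<le> real (k + 1) * t - 1"
      using ln_le_minus_one[of "real (k + 1) * t"] t by (simp add: ln_mult)
    then have *: "\<eta> * (ln (real (k + 1)) + ln t) \<le> \<eta> * (real (k + 1) * t - 1)"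
      using \<eta> by (intro mult_left_mono) auto
    then have "\<eta> * ln (real (k + 1)) \<le> (1 / 2) * ln 2 + (- \<eta> - \<eta> * ln t) + (real k / 2) * ln 2"
    proof -
      have "\<eta> * (real (k + 1) * t - 1) = real (k + 1) * (\<eta> * t) - \<eta>" by (simp add: algebra_simps)
      also have "\<eta> * t = ln 2 / 2" using \<eta> by (simp add: t_def)
      finally have "\<eta> * (real (k + 1) * t - 1) = real (k + 1) * (ln 2 / 2) - \<eta>" .
      with * show ?thesis by (simp add: algebra_simps add_divide_distrib)
    qed
    then have "exp (\<eta> * ln (real (k + 1))) \<le> exp ((1 / 2) * ln 2 + (- \<eta> - \<eta> * ln t) + (real k / 2) * ln 2)"
      by (subst exp_le_cancel_iff)
    also have "\<dots> = B * 2 powr (real k / 2)"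
      unfolding B_def powr_def exp_add by simp
    finally have le: "real (k + 1) powr \<eta> \<le> B * 2 powr (real k / 2)"
      by (simp add: powr_def)
    have "2 powr (- real k / 2) = 1 / 2 powr (real k / 2)"
      using powr_minus_divide[of 2 "real k / 2"] by simp
    also have "\<dots> \<le> B / real (k + 1) powr \<eta>"
      using le B by (subst frac_le_eq; simp add: divide_le_0_iff mult.commute)
    also have "\<dots> = B * real (k + 1) powr (- \<eta>)"
      by (subst powr_minus_divide) simp
    finally show ?thesis .
  qed
  have 2: "ln (exp 1 + 2 powr (real k / (2 * r))) powr (- \<eta>) \<le> (d / 2) powr (- \<eta>) * real (k + 1) powr (- \<eta>)" for k
  proof -
    \<comment> \<open>For \<open>k \<ge> 1\<close> one has \<open>(k + 1) / 2 \<le> k\<close>; at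
      \<open>k = 0\<close> this fails and the summand \<open>exp 1\<close> inside the logarithm
      supplies the bound.\<close>
    have "real (k + 1) * (d / 2) \<le> ln (exp 1 + 2 powr (real k / (2 * r)))"
    proof (cases "k = 0")
      case True
      have "1 = ln (exp (1::real))" by simp
      also have "\<dots> \<le> ln (exp 1 + 1)" by (subst ln_le_cancel_iff) (auto intro: add_pos_pos)
      finally show ?thesis using d True by simp
    next
      case False
      have "real (k + 1) * (d / 2) \<le> real k * d" using False d by (simp add: field_simps)
      also have "\<dots> = ln (2 powr (real k / (2 * r)))" using r by (simp add: d_def ln_powr)
      also have "\<dots> \<le> ln (exp 1 + 2 powr (real k / (2 * r)))"
        by (subst ln_le_cancel_iff) (auto intro: add_pos_pos)
      finally show ?thesis .
    qed
    then have "ln (exp 1 + 2 powr (real k / (2 * r))) powr (- \<eta>) \<le> (real (k + 1) * (d / 2)) powr (- \<eta>)"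
      using d \<eta> by (intro powr_mono2') auto
    also have "\<dots> = (d / 2) powr (- \<eta>) * real (k + 1) powr (- \<eta>)"
      using d by (subst powr_mult) auto
    finally show ?thesis .
  qed
  show ?thesis
  proof (rule that)
    show "0 < B + (d / 2) powr (- \<eta>)" using B d by (intro add_pos_pos) auto
    show "bump_decay r \<eta> k \<le> (B + (d / 2) powr (- \<eta>)) * real (k + 1) powr (- \<eta>)" for k
      unfolding bump_decay_def distrib_right by (intro add_mono 1 2)
  qed
qed

lemma luxemburg_lower_bound:
  fixes v :: "real ^ 'n \<Rightarrow> real"
  assumes r: "1 \<le> r" and \<eta>: "0 < r - 1 + \<delta>" and v: "weight v" and Q: "Q \<in> cubes"
    and R: "R \<in> sets lebesgue" "R \<subseteq> Q" "2 ^ k * measure lebesgue R \<le> measure lebesgue Q"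
    and c: "0 < c" "average Q (\<lambda>x. log_bump r \<delta> (\<bar>v x powr (1 / r)\<bar> / c)) \<le> 1"
  shows "(LINT x:R|lebesgue. v x) \<le> c powr r * (measure lebesgue Q * bump_decay r (r - 1 + \<delta>) k)"
proof -
  note Q' = cube_facts[OF Q]
  have [measurable]: "v \<in> borel_measurable lebesgue" using v by (rule weight_measurable)
  have [measurable]: "R \<in> sets lebesgue" "Q \<in> sets lebesgue" using R Q' by auto
  have bR: "bounded R" using R(2) Q'(2) bounded_subset by blast
  define T where "T = 2 powr (real k / (2 * r))"
  define L where "L = ln (exp 1 + T) powr (r - 1 + \<delta>)"
  have T: "0 < T" by (simp add: T_def)
  have lnpos: "0 < ln (exp 1 + t)" if "0 \<le> t" for t :: real
  proof -
    have "ln (exp 1) \<le> ln (exp 1 + t)" using that by (subst ln_le_cancel_iff) (auto intro: add_pos_nonneg)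
    then show ?thesis by simp
  qed
  have L: "0 < L" using lnpos[of T] T by (simp add: L_def)
  define B where "B x = log_bump r \<delta> (\<bar>v x powr (1 / r)\<bar> / c)" for x
  have B0: "0 \<le> B x" for x by (simp add: B_def log_bump_def)
  have [measurable]: "B \<in> borel_measurable lebesgue"
    unfolding B_def[abs_def] log_bump_def by measurable
  \<comment> \<open>With \<open>t = v x powr (1 / r) / c\<close>, the first summand bounds
    \<open>v x\<close> for \<open>t \<le> T\<close>; for larger \<open>t\<close> the logarithmic
    factor of the bump is at least \<open>L\<close>, and the second summand does.\<close>
  have pw: "v x \<le> c powr r * T powr r + c powr r / L * B x" for x
  proof -
    define t where "t = v x powr (1 / r) / c"
    have t: "0 \<le> t" using c by (simp add: t_def)
    have vt: "v x = c powr r * t powr r"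
      using c r weight_nonneg[OF v, of x] by (simp add: t_def powr_divide powr_powr)
    have Bt: "B x = t powr r * ln (exp 1 + t) powr (r - 1 + \<delta>)"
      using c by (simp add: B_def log_bump_def t_def)
    show ?thesis
    proof (cases "t \<le> T")
      case True
      then have "v x \<le> c powr r * T powr r"
        unfolding vt using t r by (intro mult_left_mono powr_mono2) auto
      moreover have "0 \<le> c powr r / L * B x" using L B0 by auto
      ultimately show ?thesis by simp
    next
      case False
      have "L \<le> ln (exp 1 + t) powr (r - 1 + \<delta>)"
        unfolding L_def using False T \<eta> lnpos[of T]
        by (intro powr_mono2 ln_mono) (auto intro: add_pos_pos)
      then have "t powr r * L \<le> B x" unfolding Bt by (intro mult_left_mono) auto
      then have "c powr r / L * (t powr r * L) \<le> c powr r / L * B x"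
        using L by (intro mult_left_mono) auto
      moreover have "c powr r / L * (t powr r * L) = v x" using L vt by simp
      moreover have "0 \<le> c powr r * T powr r" by simp
      ultimately show ?thesis by linarith
    qed
  qed
  have intB: "(\<integral>\<^sup>+x\<in>Q. ennreal (B x) \<partial>lebesgue) \<le> ennreal (measure lebesgue Q)"
  proof -
    have "(\<integral>\<^sup>+x\<in>Q. ennreal (B x) \<partial>lebesgue) / ennreal (measure lebesgue Q) \<le> 1"
      using c(2) unfolding average_def B_def Q'(4) .
    from mult_right_mono[OF this, of "ennreal (measure lebesgue Q)"]
    show ?thesis using Q'(3) by (simp add: ennreal_divide_times)
  qed
  have mR: "emeasure lebesgue R = ennreal (measure lebesgue R)"
  proof (rule emeasure_eq_ennreal_measure)
    have "emeasure lebesgue R \<le> emeasure lebesgue Q" using R by (intro emeasure_mono) auto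
    then show "emeasure lebesgue R \<noteq> top" using Q'(4) by (auto simp: top_unique)
  qed
  have "ennreal (LINT x:R|lebesgue. v x) = (\<integral>\<^sup>+x\<in>R. ennreal (v x) \<partial>lebesgue)"
    using nn_set_integral_weight[OF v bR R(1)] by simp
  also have "\<dots> \<le> (\<integral>\<^sup>+x. ennreal (c powr r * T powr r) * indicator R x +
      ennreal (c powr r / L) * (ennreal (B x) * indicator Q x) \<partial>lebesgue)"
  proof (intro nn_integral_mono)
    fix x
    have "ennreal (v x) \<le> ennreal (c powr r * T powr r + c powr r / L * B x)"
      using pw by (intro ennreal_leI)
    also have "\<dots> = ennreal (c powr r * T powr r) + ennreal (c powr r / L) * ennreal (B x)"
    proof -
      have "ennreal (c powr r / L * B x) = ennreal (c powr r / L) * ennreal (B x)"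
        using B0 L by (intro ennreal_mult) auto
      then show ?thesis using B0 L by (subst ennreal_plus) auto
    qed
    finally show "ennreal (v x) * indicator R x \<le> ennreal (c powr r * T powr r) * indicator R x +
        ennreal (c powr r / L) * (ennreal (B x) * indicator Q x)"
      using R(2) by (auto simp: indicator_def)
  qed
  also have "\<dots> = ennreal (c powr r * T powr r) * emeasure lebesgue R +
      ennreal (c powr r / L) * (\<integral>\<^sup>+x\<in>Q. ennreal (B x) \<partial>lebesgue)"
    by (subst nn_integral_add) (auto simp: nn_integral_cmult nn_integral_cmult_indicator)
  also have "\<dots> \<le> ennreal (c powr r * T powr r) * ennreal (measure lebesgue R) +
      ennreal (c powr r / L) * ennreal (measure lebesgue Q)"
    unfolding mR using intB by (intro add_mono mult_left_mono) auto
  also have "\<dots> = ennreal (c powr r * T powr r * measure lebesgue R + c powr r / L * measure lebesgue Q)"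
  proof -
    have "ennreal a * ennreal b + ennreal a' * ennreal b' = ennreal (a * b + a' * b')"
      if "0 \<le> a" "0 \<le> b" "0 \<le> a'" "0 \<le> b'" for a b a' b'
      using that by (simp add: ennreal_mult)
    then show ?thesis by this (use L in auto)
  qed
  finally have "(LINT x:R|lebesgue. v x) \<le> c powr r * T powr r * measure lebesgue R + c powr r / L * measure lebesgue Q"
    using L by (subst (asm) ennreal_le_iff) auto
  \<comment> \<open>\<open>T powr r = 2 powr (k / 2)\<close> spends half of the gain
    \<open>2 powr (- k)\<close> from the small measure of \<open>R\<close>.\<close>
  also have "\<dots> \<le> c powr r * (2 powr (- real k / 2) * measure lebesgue Q) + c powr r / L * measure lebesgue Q"
  proof -
    have "T powr r = 2 powr (real k / 2)" using r by (simp add: T_def powr_powr)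
    also have "\<dots> = 2 powr (- real k / 2) * 2 powr (real k)" unfolding powr_add[symmetric] by simp
    finally have "T powr r * measure lebesgue R = 2 powr (- real k / 2) * (2 ^ k * measure lebesgue R)"
      by (simp add: powr_realpow)
    also have "\<dots> \<le> 2 powr (- real k / 2) * measure lebesgue Q" using R(3) by (intro mult_left_mono) auto
    finally show ?thesis by (simp add: mult.assoc mult_left_mono)
  qed
  also have "\<dots> = c powr r * (measure lebesgue Q * bump_decay r (r - 1 + \<delta>) k)"
    unfolding bump_decay_def T_def[symmetric] powr_minus[of "ln _"] L_def[symmetric] by (simp add: field_simps)
  finally show ?thesis .
qed

text \<open>The two local norms are averages, which costs the powers \<open>1 / r\<close> and
  \<open>1 / s\<close> of the measure of \<open>Q\<close>; the rest is the lower bound for the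
  Luxemburg norm. The parameters are free so that both bump conditions are instances.\<close>

lemma bump_condition_tail:
  fixes v \<omega> :: "real ^ 'n \<Rightarrow> real"
  assumes r: "1 \<le> r" and \<eta>: "0 < r - 1 + \<delta>" and s: "0 < s" and v: "weight v" and \<omega>: "weight \<omega>" and Q: "Q \<in> cubes"
    and R: "R \<in> sets lebesgue" "R \<subseteq> Q" "2 ^ k * measure lebesgue R \<le> measure lebesgue Q"
    and K: "0 \<le> K" "ennreal (measure lebesgue Q powr \<gamma>) * luxemburg_norm (log_bump r \<delta>) Q (\<lambda>x. v x powr (1 / r))
      * local_norm s Q (\<lambda>x. \<omega> x powr (1 / s)) \<le> ennreal K"
  shows "measure lebesgue Q powr (\<gamma> - 1 / r - 1 / s) * (LINT x:Q|lebesgue. \<omega> x) powr (1 / s) *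
    (LINT x:R|lebesgue. v x) powr (1 / r) \<le> K * bump_decay r (r - 1 + \<delta>) k powr (1 / r)"
proof -
  note Q' = cube_facts[OF Q]
  define m where "m = measure lebesgue Q"
  define b where "b = bump_decay r (r - 1 + \<delta>) k"
  define W where "W = (LINT x:Q|lebesgue. \<omega> x)"
  define V where "V = (LINT x:R|lebesgue. v x)"
  have m: "0 < m" using Q' by (simp add: m_def)
  have b: "0 < b" by (simp add: b_def bump_decay_def add_pos_nonneg)
  have WV: "0 \<le> W" "0 \<le> V" unfolding W_def V_def by (intro set_integral_nonneg' weight_nonneg v \<omega>)+
  have "average Q (\<lambda>x. \<bar>\<omega> x powr (1 / s)\<bar> powr s) = ennreal (W / m)"
    using nn_set_integral_weight[OF \<omega> Q'(2) Q'(1)] s weight_nonneg[OF \<omega>] Q'(3) WV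
    by (simp add: average_def powr_powr Q'(4) W_def m_def divide_ennreal)
  then have loc: "local_norm s Q (\<lambda>x. \<omega> x powr (1 / s)) = ennreal ((W / m) powr (1 / s))"
    using WV m by (simp add: local_norm_def epowr_def)
  \<comment> \<open>The bound holds for every competitor and so for the infimum, also when there is
    none and the norm is \<infinity>.\<close>
  have lux: "ennreal ((V / (m * b)) powr (1 / r)) \<le> luxemburg_norm (log_bump r \<delta>) Q (\<lambda>x. v x powr (1 / r))"
    unfolding luxemburg_norm_def
  proof (rule Inf_greatest)
    fix y assume "y \<in> {ennreal c |c. 0 < c \<and> average Q (\<lambda>x. log_bump r \<delta> (\<bar>v x powr (1 / r)\<bar> / c)) \<le> 1}"
    then obtain c where c: "y = ennreal c" "0 < c" "average Q (\<lambda>x. log_bump r \<delta> (\<bar>v x powr (1 / r)\<bar> / c)) \<le> 1"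
      by auto
    have "V \<le> c powr r * (m * b)"
      unfolding V_def m_def b_def using r \<eta> v Q R c(2,3) by (rule luxemburg_lower_bound)
    then have "V / (m * b) \<le> c powr r" using m b by (simp add: divide_le_eq)
    then have "(V / (m * b)) powr (1 / r) \<le> (c powr r) powr (1 / r)"
      using WV m b r by (intro powr_mono2) auto
    then show "ennreal ((V / (m * b)) powr (1 / r)) \<le> y"
      using c r by (auto simp: powr_powr intro!: ennreal_leI)
  qed
  have "ennreal (m powr \<gamma> * (V / (m * b)) powr (1 / r) * (W / m) powr (1 / s)) =
      ennreal (m powr \<gamma>) * ennreal ((V / (m * b)) powr (1 / r)) * ennreal ((W / m) powr (1 / s))"
    by (simp add: ennreal_mult)
  also have "\<dots> \<le> ennreal (m powr \<gamma>) * luxemburg_norm (log_bump r \<delta>) Q (\<lambda>x. v x powr (1 / r)) * ennreal ((W / m) powr (1 / s))"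
    using lux by (intro mult_right_mono mult_left_mono) auto
  also have "\<dots> \<le> ennreal K" using K(2) by (simp add: loc m_def)
  finally have "m powr \<gamma> * (V / (m * b)) powr (1 / r) * (W / m) powr (1 / s) \<le> K"
    using K(1) by (subst (asm) ennreal_le_iff) auto
  moreover have "m powr \<gamma> * (V / (m * b)) powr (1 / r) * (W / m) powr (1 / s) =
      (m powr (\<gamma> - 1 / r - 1 / s) * W powr (1 / s) * V powr (1 / r)) / b powr (1 / r)"
    using m b WV by (simp add: powr_divide powr_mult powr_diff mult_ac)
  ultimately show ?thesis using b by (simp add: V_def W_def m_def b_def divide_le_eq)
qed

lemma summable_bump_decay:
  assumes r: "1 \<le> r" and \<eta>: "0 < \<eta>" and e: "0 < e" "1 < \<eta> * e"
  shows "summable (\<lambda>k. bump_decay r \<eta> k powr e)"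
proof -
  obtain C where C: "0 < C" "\<And>k. bump_decay r \<eta> k \<le> C * real (k + 1) powr (- \<eta>)"
    using bump_decay_le[OF r \<eta>] by blast
  have "summable (\<lambda>k. real k powr (- (\<eta> * e)))" using e by (subst summable_real_powr_iff) auto
  then have "summable (\<lambda>k. real (Suc k) powr (- (\<eta> * e)))" by (subst summable_Suc_iff)
  then have "summable (\<lambda>k. C powr e * real (Suc k) powr (- (\<eta> * e)))" by (rule summable_mult)
  then show ?thesis
  proof (rule summable_comparison_test'[where N = 0])
    fix k
    have "bump_decay r \<eta> k powr e \<le> (C * real (k + 1) powr (- \<eta>)) powr e"
      using C e by (intro powr_mono2) (auto simp: bump_decay_def)
    also have "\<dots> = C powr e * real (Suc k) powr (- (\<eta> * e))"
      using C by (simp add: powr_mult powr_powr)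
    finally show "norm (bump_decay r \<eta> k powr e) \<le> C powr e * real (Suc k) powr (- (\<eta> * e))" by simp
  qed
qed

subsection \<open>Shifted dyadic grids\<close>

text \<open>
  The one-third trick. The sign of the offset alternates with the scale so that its change from one scale to
  the next is a multiple of the smaller scale, which keeps the shifted grid nested.
\<close>

definition grid_offset :: "('n \<Rightarrow> bool) \<Rightarrow> int \<Rightarrow> 'n \<Rightarrow> real" where
  "grid_offset t k i = (if t i then if even k then 1 / 3 else - (1 / 3) else 0)"

text \<open>Encoding a cell by its integer index turns nestedness of the grid into the fact that the
  index at a coarser scale is a function of the finer one.\<close>

definition dcell :: "('n \<Rightarrow> bool) \<Rightarrow> int \<Rightarrow> real ^ 'n \<Rightarrow> 'n \<Rightarrow> int" where
  "dcell t k x = (\<lambda>i. \<lfloor>x $ i / 2 powr k - grid_offset t k i\<rfloor>)"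

definition dcube :: "('n \<Rightarrow> bool) \<Rightarrow> int \<Rightarrow> ('n \<Rightarrow> int) \<Rightarrow> (real ^ 'n) set" where
  "dcube t k m = {x. dcell t k x = m}"

text \<open>If z is the shifted coordinate at scale \<open>k\<close> and o its offset, the one at
  scale \<open>k + 1\<close> is (z + 3 o) / 2, because the offset changes sign. As 3 o is an
  integer, the floor depends on the floor of z only.\<close>

lemma dcell_Suc:
  fixes x :: "real ^ 'n"
  shows "dcell t (k + 1) x = (\<lambda>i. (dcell t k x i + \<lfloor>3 * grid_offset t k i\<rfloor>) div 2)"
proof
  fix i
  define z where "z = x $ i / 2 powr k - grid_offset t k i"
  obtain e :: int where e: "3 * grid_offset t k i = of_int e"
    by (cases "t i"; cases "even k") (auto simp: grid_offset_def intro: that[of 1] that[of "-1"] that[of 0])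
  have two: "2 powr real_of_int (k + 1) = 2 * (2::real) powr real_of_int k" by (simp add: powr_add)
  have flip: "grid_offset t (k + 1) i = - grid_offset t k i" by (simp add: grid_offset_def)
  have "x $ i / 2 powr (k + 1) - grid_offset t (k + 1) i = (z + 3 * grid_offset t k i) / of_int 2"
    unfolding flip z_def two by (simp add: field_simps)
  also have "\<lfloor>\<dots>\<rfloor> = \<lfloor>z + 3 * grid_offset t k i\<rfloor> div 2"
    by (rule floor_divide_real_eq_div) simp
  finally show "dcell t (k + 1) x i = (dcell t k x i + \<lfloor>3 * grid_offset t k i\<rfloor>) div 2"
    by (simp add: dcell_def z_def[symmetric] e)
qed

lemma dcell_mono:
  fixes x y :: "real ^ 'n"
  assumes "k \<le> l" "dcell t k x = dcell t k y"
  shows "dcell t l x = dcell t l y"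
  using assms(1)
proof (induction l rule: int_ge_induct)
  case (step l)
  then show ?case by (simp add: dcell_Suc)
qed (use assms in simp)

lemma dcube_nested:
  assumes "k \<le> l" "dcube t k m \<inter> dcube t l m' \<noteq> {}"
  shows "dcube t k m \<subseteq> dcube t l m'"
proof -
  obtain x where x: "dcell t k x = m" "dcell t l x = m'" using assms(2) by (auto simp: dcube_def)
  show ?thesis
  proof
    fix y assume "y \<in> dcube t k m"
    then have "dcell t k x = dcell t k y" using x by (simp add: dcube_def)
    from dcell_mono[OF assms(1) this] show "y \<in> dcube t l m'" using x by (simp add: dcube_def)
  qed
qed

text \<open>The half-open cube lies between an open box and its closure, which have equal volume.
  The closed one belongs to \<open>cubes\<close>, where the bump conditions are available.\<close>

lemma dcube_facts:
  fixes t :: "'n::finite \<Rightarrow> bool"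
  shows dcube_lebesgue: "dcube t k m \<in> sets lebesgue"
    and measure_dcube: "measure lebesgue (dcube t k m) = 2 powr (real_of_int k * real CARD('n))"
    and dcube_subset_cube: "\<exists>Q\<in>cubes. dcube t k m \<subseteq> Q \<and> measure lebesgue Q = measure lebesgue (dcube t k m)"
proof -
  define l where "l = (2::real) powr k"
  have l: "0 < l" by (simp add: l_def)
  define a :: "real ^ 'n" where "a = (\<chi> i. l * (of_int (m i) + grid_offset t k i))"
  define b where "b = a + (\<chi> i. l)"
  have ab: "a $ i < b $ i" for i using l by (simp add: b_def)
  have eq: "dcube t k m = (\<Inter>i. {x. a $ i \<le> x $ i} \<inter> {x. x $ i < b $ i})"
  proof -
    have "\<lfloor>x $ i / l - grid_offset t k i\<rfloor> = m i \<longleftrightarrow> a $ i \<le> x $ i \<and> x $ i < b $ i" for x :: "real ^ 'n" and i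
      using l by (auto simp: floor_eq_iff a_def b_def field_simps)
    then show ?thesis by (auto simp: dcube_def dcell_def l_def[symmetric] fun_eq_iff)
  qed
  have "{x. a $ i \<le> x $ i} \<inter> {x. x $ i < b $ i} \<in> sets borel" for i
    by (intro sets.Int borel_closed borel_open closed_halfspace_component_ge_cart open_halfspace_component_lt_cart)
  then have "dcube t k m \<in> sets borel" unfolding eq by (intro sets.finite_INT) auto
  then show D: "dcube t k m \<in> sets lebesgue" by simp
  have sub: "box a b \<subseteq> dcube t k m" "dcube t k m \<subseteq> cbox a b"
    by (auto simp: eq mem_box_cart less_eq_real_def)
  have ne: "cbox a b \<noteq> {}" using ab by (auto simp: interval_ne_empty_cart intro: less_imp_le)
  have mc: "measure lebesgue (cbox a b) = 2 powr (real_of_int k * real CARD('n))"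
  proof -
    have "measure lebesgue (cbox a b) = (\<Prod>i\<in>(UNIV::'n set). l)"
      using content_cbox_cart[OF ne] by (subst measure_completion) (simp_all add: b_def)
    also have "\<dots> = 2 powr (real_of_int k * real CARD('n))"
      by (simp add: l_def powr_realpow[symmetric] powr_powr)
    finally show ?thesis .
  qed
  have mb: "measure lebesgue (box a b) = measure lebesgue (cbox a b)"
    by (simp add: measure_lborel_box_eq measure_lborel_cbox_eq)
  have Dm: "dcube t k m \<in> lmeasurable"
    using D sub(2) by (meson bounded_cbox bounded_set_imp_lmeasurable bounded_subset)
  have "measure lebesgue (box a b) \<le> measure lebesgue (dcube t k m)"
    using sub Dm by (intro measure_mono_fmeasurable) auto
  moreover have "measure lebesgue (dcube t k m) \<le> measure lebesgue (cbox a b)"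
    using sub D by (intro measure_mono_fmeasurable) auto
  ultimately have eqm: "measure lebesgue (dcube t k m) = measure lebesgue (cbox a b)" using mb by simp
  then show "measure lebesgue (dcube t k m) = 2 powr (real_of_int k * real CARD('n))" using mc by simp
  have "cbox a b \<in> cubes" using l by (auto simp: cubes_def b_def)
  then show "\<exists>Q\<in>cubes. dcube t k m \<subseteq> Q \<and> measure lebesgue Q = measure lebesgue (dcube t k m)"
    using sub eqm by metis
qed

text \<open>If both floors differed, the short interval between the points would contain an integer
  and a number of the form integer plus \<tau>. Such numbers are at least 1/3 apart.\<close>

lemma floor_eq_or_shifted_floor_eq:
  fixes a b \<tau> :: real
  assumes "\<bar>a - b\<bar> < 1 / 3" "\<tau> = 1 / 3 \<or> \<tau> = - (1 / 3)"
  shows "\<lfloor>a\<rfloor> = \<lfloor>b\<rfloor> \<or> \<lfloor>a - \<tau>\<rfloor> = \<lfloor>b - \<tau>\<rfloor>"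
proof -
  have wlog: "\<lfloor>a\<rfloor> = \<lfloor>b\<rfloor> \<or> \<lfloor>a - \<tau>\<rfloor> = \<lfloor>b - \<tau>\<rfloor>" if "a \<le> b" "b - a < 1 / 3" for a b
  proof (rule ccontr)
    assume neg: "\<not> ?thesis"
    have "\<lfloor>a\<rfloor> \<le> \<lfloor>b\<rfloor>" "\<lfloor>a - \<tau>\<rfloor> \<le> \<lfloor>b - \<tau>\<rfloor>" using that by (auto intro!: floor_mono)
    with neg have "\<lfloor>a\<rfloor> < \<lfloor>b\<rfloor>" "\<lfloor>a - \<tau>\<rfloor> < \<lfloor>b - \<tau>\<rfloor>" by auto
    then have "a < \<lfloor>b\<rfloor>" "a - \<tau> < \<lfloor>b - \<tau>\<rfloor>" by (auto simp: floor_less_iff)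
    moreover have "\<lfloor>b\<rfloor> \<le> b" "\<lfloor>b - \<tau>\<rfloor> \<le> b - \<tau>" by simp_all
    ultimately have z: "\<bar>real_of_int (\<lfloor>b\<rfloor> - \<lfloor>b - \<tau>\<rfloor>) - \<tau>\<bar> < 1 / 3"
      using that unfolding of_int_diff by linarith
    define z where "z = \<lfloor>b\<rfloor> - \<lfloor>b - \<tau>\<rfloor>"
    from z have z: "real_of_int z - \<tau> < 1 / 3" "- (1 / 3) < real_of_int z - \<tau>"
      unfolding z_def[symmetric] by linarith+
    from assms(2) have "real_of_int z < 1 \<and> - 1 < real_of_int z \<and> real_of_int z \<noteq> 0"
      using z by (elim disjE) auto
    then show False by auto
  qed
  show ?thesis using wlog[of a b] wlog[of b a] assms(1) by (cases "a \<le> b") auto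
qed

lemma common_dcell:
  fixes x y :: "real ^ 'n"
  assumes "x \<noteq> y"
  obtains t k where "dcell t k x = dcell t k y" "2 powr real_of_int k \<le> 6 * norm (x - y)"
proof -
  define d where "d = norm (x - y)"
  have d: "0 < d" using assms by (simp add: d_def)
  \<comment> \<open>This makes \<open>3 * d < 2 powr k \<le> 6 * d\<close>: the lower bound brings
    the scaled coordinates within 1/3, the upper one is needed to compare with the kernel.\<close>
  define k where "k = \<lfloor>log 2 (6 * d)\<rfloor>"
  have up: "2 powr real_of_int k \<le> 6 * d"
  proof -
    have "2 powr real_of_int k \<le> 2 powr (log 2 (6 * d))" unfolding k_def by (intro powr_mono) linarith+
    then show ?thesis using d by simp
  qed
  have lo: "3 * d < 2 powr real_of_int k"
  proof -
    have "6 * d = 2 powr (log 2 (6 * d))" using d by simp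
    also have "\<dots> < 2 powr (real_of_int k + 1)" unfolding k_def by (intro powr_less_mono) linarith+
    finally show ?thesis by (simp add: powr_add)
  qed
  define A where "A i = x $ i / 2 powr k" for i
  define B where "B i = y $ i / 2 powr k" for i
  \<comment> \<open>The grid is shifted exactly in the coordinates in which the standard one
    separates the points.\<close>
  define t where "t i \<longleftrightarrow> \<lfloor>A i\<rfloor> \<noteq> \<lfloor>B i\<rfloor>" for i
  have "\<lfloor>A i - grid_offset t k i\<rfloor> = \<lfloor>B i - grid_offset t k i\<rfloor>" for i
  proof -
    have "\<bar>x $ i - y $ i\<bar> \<le> d" using component_le_norm_cart[of "x - y" i] by (simp add: d_def)
    then have "\<bar>x $ i - y $ i\<bar> < 2 powr k / 3" using lo by simp
    then have "\<bar>A i - B i\<bar> < 1 / 3"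
      by (simp add: A_def B_def diff_divide_distrib[symmetric] field_simps)
    then show ?thesis
      using floor_eq_or_shifted_floor_eq[of "A i" "B i" "if even k then 1 / 3 else - (1 / 3)"]
      by (cases "t i") (auto simp: grid_offset_def t_def)
  qed
  then have "dcell t k x = dcell t k y" by (simp add: dcell_def A_def B_def)
  then show ?thesis using up by (intro that) (auto simp: d_def)
qed

text \<open>Finite pieces that exhaust the grid: estimates are made for finite families, uniformly
  in \<open>N\<close>, and the limit is taken last.\<close>

definition dgrid :: "('n \<Rightarrow> bool) \<Rightarrow> nat \<Rightarrow> (real ^ 'n) set set" where
  "dgrid t N = (\<lambda>(k, m). dcube t k m) ` ({k. \<bar>k\<bar> \<le> int N} \<times> {m. \<forall>i. \<bar>m i\<bar> \<le> int N})"

lemma finite_dgrid: "finite (dgrid (t :: 'n::finite \<Rightarrow> bool) N)"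
proof -
  have fin: "finite {k. \<bar>k\<bar> \<le> int N}"
    by (rule finite_subset[of _ "{- int N..int N}"]) auto
  have "{m. \<forall>i. \<bar>m i\<bar> \<le> int N} = PiE (UNIV :: 'n set) (\<lambda>_. {k. \<bar>k\<bar> \<le> int N})"
    by (auto simp: PiE_def)
  moreover have "finite \<dots>" using fin by (intro finite_PiE) auto
  ultimately show ?thesis
    unfolding dgrid_def using fin by (intro finite_imageI finite_cartesian_product) auto
qed

lemma dgrid_mono: "N \<le> N' \<Longrightarrow> dgrid t N \<subseteq> dgrid t N'"
  unfolding dgrid_def by (intro image_mono Sigma_mono) (auto intro: order_trans[of _ "int N"])

lemma dgrid_dcube: "A \<in> dgrid t N \<Longrightarrow> \<exists>k m. A = dcube t k m"
  unfolding dgrid_def by auto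

lemma dcube_in_dgrid:
  fixes t :: "'n::finite \<Rightarrow> bool"
  shows "\<exists>N. dcube t k m \<in> dgrid t N"
proof -
  define N where "N = nat (\<bar>k\<bar> + (\<Sum>i\<in>UNIV. \<bar>m i\<bar>))"
  have s0: "0 \<le> (\<Sum>i\<in>UNIV. \<bar>m i\<bar>)" by (intro sum_nonneg) auto
  have "\<bar>m i\<bar> \<le> (\<Sum>i\<in>UNIV. \<bar>m i\<bar>)" for i by (intro member_le_sum) auto
  then have "\<bar>m i\<bar> \<le> int N" for i using s0 by (simp add: N_def add_increasing)
  moreover have "\<bar>k\<bar> \<le> int N" using s0 by (simp add: N_def)
  ultimately show ?thesis unfolding dgrid_def by (intro exI[of _ N]) auto
qed

text \<open>One common cube of side at most 6 |x - y| suffices, since |Q| to the power \<alpha>/n -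
  1 is its side to the power \<alpha> - n and all other terms are nonnegative. The piece
  \<open>N\<close> depends on the two points.\<close>

lemma riesz_kernel_dyadic:
  fixes x y :: "real ^ 'n"
  assumes \<alpha>: "\<alpha> < real CARD('n)"
  shows "\<exists>N. riesz_kernel \<alpha> x y \<le> 6 powr (real CARD('n) - \<alpha>) *
    (\<Sum>t\<in>UNIV. \<Sum>Q\<in>dgrid t N. measure lebesgue Q powr (- (1 - \<alpha> / real CARD('n))) * indicator Q x * indicator Q y)"
proof (cases "x = y")
  case True
  \<comment> \<open>On the diagonal the kernel has the value \<open>1 / 0 = 0\<close>.\<close>
  then show ?thesis by (auto simp: riesz_kernel_def intro!: exI[of _ 0] mult_nonneg_nonneg sum_nonneg)
next
  case False
  then obtain t k where tk: "dcell t k x = dcell t k y" "2 powr real_of_int k \<le> 6 * norm (x - y)"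
    by (rule common_dcell)
  let ?n = "real CARD('n)"
  let ?w = "\<lambda>Q. measure lebesgue Q powr (- (1 - \<alpha> / ?n)) * indicat_real Q x * indicat_real Q y"
  define Q where "Q = dcube t k (dcell t k x)"
  obtain N where N: "Q \<in> dgrid t N" unfolding Q_def using dcube_in_dgrid by blast
  have xy: "x \<in> Q" "y \<in> Q" using tk(1) by (auto simp: Q_def dcube_def)
  have "?w Q = (2 powr real_of_int k) powr (- (?n - \<alpha>))"
  proof -
    have "real_of_int k * ?n * - (1 - \<alpha> / ?n) = real_of_int k * - (?n - \<alpha>)" by (simp add: field_simps)
    then show ?thesis using xy by (simp only: Q_def measure_dcube powr_powr) simp
  qed
  also have "(2 powr real_of_int k) powr (- (?n - \<alpha>)) \<ge> (6 * norm (x - y)) powr (- (?n - \<alpha>))"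
    using tk(2) \<alpha> by (intro powr_mono2') auto
  also have "(6 * norm (x - y)) powr (- (?n - \<alpha>)) = 6 powr (- (?n - \<alpha>)) * riesz_kernel \<alpha> x y"
    unfolding riesz_kernel_def powr_minus_divide[of "norm _", symmetric] by (rule powr_mult)
  finally have "6 powr (- (?n - \<alpha>)) * riesz_kernel \<alpha> x y \<le> ?w Q" .
  also have "?w Q \<le> (\<Sum>Q\<in>dgrid t N. ?w Q)"
    using N by (intro member_le_sum finite_dgrid) auto
  also have "\<dots> \<le> (\<Sum>t\<in>UNIV. \<Sum>Q\<in>dgrid t N. ?w Q)"
    by (intro member_le_sum[of t UNIV "\<lambda>t. \<Sum>Q\<in>dgrid t N. ?w Q"]) (auto intro!: sum_nonneg)
  finally have "6 powr (- (?n - \<alpha>)) * riesz_kernel \<alpha> x y \<le> (\<Sum>t\<in>UNIV. \<Sum>Q\<in>dgrid t N. ?w Q)" .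
  then have "6 powr (?n - \<alpha>) * (6 powr (- (?n - \<alpha>)) * riesz_kernel \<alpha> x y) \<le>
      6 powr (?n - \<alpha>) * (\<Sum>t\<in>UNIV. \<Sum>Q\<in>dgrid t N. ?w Q)"
    by (rule mult_left_mono) simp
  moreover have "6 powr (?n - \<alpha>) * 6 powr (- (?n - \<alpha>)) = (1::real)"
    unfolding powr_add[symmetric] by simp
  ultimately have "riesz_kernel \<alpha> x y \<le> 6 powr (?n - \<alpha>) * (\<Sum>t\<in>UNIV. \<Sum>Q\<in>dgrid t N. ?w Q)"
    by (simp only: mult.assoc[symmetric] mult_1_left)
  then show ?thesis by blast
qed

section \<open>Dyadic operators for locally integrable weights\<close>

lemma set_integral_weight_mono:
  assumes "weight w" "bounded B" "A \<in> sets lebesgue" "B \<in> sets lebesgue" "A \<subseteq> B"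
  shows "(LINT x:A|lebesgue. w x) \<le> (LINT x:B|lebesgue. w x)"
proof -
  have "bounded A" using assms bounded_subset by blast
  then have "integrable lebesgue (\<lambda>x. indicator A x *\<^sub>R w x)" "integrable lebesgue (\<lambda>x. indicator B x *\<^sub>R w x)"
    using weight_set_integrable[OF assms(1)] assms by (auto simp: set_integrable_def)
  then show ?thesis
    unfolding set_lebesgue_integral_def using assms(5) weight_nonneg[OF assms(1)]
    by (intro integral_mono) (auto simp: indicator_def)
qed

lemma dcube_bounded: "bounded (dcube t k m :: (real ^ 'n) set)"
  using dcube_subset_cube[of t k m] cube_facts(2) bounded_subset by blast

text \<open>The sum is at most the number of terms times the largest term, whose power is one of the
  summands on the right.\<close>

lemma sum_powr_le:
  fixes x :: "'i \<Rightarrow> real"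
  assumes "finite I" "I \<noteq> {}" "\<And>i. i \<in> I \<Longrightarrow> 0 \<le> x i" "0 < q"
  shows "(\<Sum>i\<in>I. x i) powr q \<le> (\<Sum>i\<in>I. (real (card I) * x i) powr q)"
proof -
  obtain j where j: "j \<in> I" "\<And>i. i \<in> I \<Longrightarrow> x i \<le> x j"
    using Max_in[of "x ` I"] Max_ge[of "x ` I"] assms(1,2) by fastforce
  have "(\<Sum>i\<in>I. x i) \<le> real (card I) * x j"
    using sum_bounded_above[of I x "x j"] j by simp
  then have "(\<Sum>i\<in>I. x i) powr q \<le> (real (card I) * x j) powr q"
    using assms by (intro powr_mono2 sum_nonneg) auto
  also have "\<dots> \<le> (\<Sum>i\<in>I. (real (card I) * x i) powr q)"
    using assms j(1) by (intro member_le_sum[of j I "\<lambda>i. (real (card I) * x i) powr q"]) auto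
  finally show ?thesis .
qed

locale tailed_weights =
  fixes \<sigma> u :: "real ^ 'n \<Rightarrow> real" and a b \<kappa> K :: real and c1 c2 :: "nat \<Rightarrow> real"
  assumes ab: "0 < b" "b < a" "a < 1" and \<kappa>: "0 < \<kappa>" and K: "0 \<le> K"
    and \<sigma>: "weight \<sigma>" and u: "weight u"
    and tail1: "\<And>Q R k. Q \<in> cubes \<Longrightarrow> R \<in> sets lebesgue \<Longrightarrow> R \<subseteq> Q \<Longrightarrow>
      2 ^ k * measure lebesgue R \<le> measure lebesgue Q \<Longrightarrow>
      measure lebesgue Q powr (- \<kappa>) * (LINT x:Q|lebesgue. \<sigma> x) powr (1 - a) * (LINT x:R|lebesgue. u x) powr b \<le> c1 k"
    and tail2: "\<And>Q R k. Q \<in> cubes \<Longrightarrow> R \<in> sets lebesgue \<Longrightarrow> R \<subseteq> Q \<Longrightarrow>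
      2 ^ k * measure lebesgue R \<le> measure lebesgue Q \<Longrightarrow>
      measure lebesgue Q powr (- \<kappa>) * (LINT x:Q|lebesgue. u x) powr b * (LINT x:R|lebesgue. \<sigma> x) powr (1 - a) \<le> c2 k"
    and c1: "\<And>n. (\<Sum>k<n. c1 k powr (1 / (1 - a))) \<le> K powr (1 / (1 - a))"
    and c2: "\<And>n. (\<Sum>k<n. c2 k powr (1 / b)) \<le> K powr (1 / b)"
begin

text \<open>The abstract system asks for integrable weights, so both weights are cut off to the
  bounded union \<open>B\<close> of the family. This changes no integral over a member.\<close>

lemma dyadic_bound:
  fixes t :: "'n \<Rightarrow> bool"
  assumes S: "finite S" "\<And>A. A \<in> S \<Longrightarrow> \<exists>k m. A = dcube t k m"
    and \<phi>: "integrable lebesgue \<phi>" "\<And>x. 0 \<le> \<phi> x"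
  defines "T \<equiv> \<lambda>x. \<Sum>Q\<in>S. measure lebesgue Q powr (- \<kappa>) *
    (LINT y:Q|lebesgue. \<phi> y powr a * \<sigma> y powr (1 - a)) * indicator Q x"
  shows "integrable lebesgue (\<lambda>x. T x powr (1 / b) * u x)"
    and "(\<integral>x. T x powr (1 / b) * u x \<partial>lebesgue) \<le>
      (laminar_const a b \<kappa> * K * (\<integral>x. \<phi> x \<partial>lebesgue) powr a) powr (1 / b)"
proof -
  define B where "B = \<Union>S"
  have Sm: "A \<in> sets lebesgue" "bounded A" "0 < measure lebesgue A" if "A \<in> S" for A
    using S(2)[OF that] by (auto simp: dcube_lebesgue dcube_bounded measure_dcube)
  have B: "B \<in> sets lebesgue" "bounded B" using S(1) Sm by (auto simp: B_def)
  define \<sigma>B where "\<sigma>B x = indicator B x * \<sigma> x" for x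
  define uB where "uB x = indicator B x * u x" for x
  have \<sigma>B: "(LINT x:Q|lebesgue. \<sigma>B x) = (LINT x:Q|lebesgue. \<sigma> x)" and uB: "(LINT x:Q|lebesgue. uB x) = (LINT x:Q|lebesgue. u x)"
    if "Q \<in> S" for Q
    unfolding set_lebesgue_integral_def using that
    by (auto intro!: Bochner_Integration.integral_cong simp: \<sigma>B_def uB_def B_def indicator_def)
  \<comment> \<open>The bounds are given for closed cubes. Passing from a dyadic cube to a closed
    one keeps the measure and can only increase the weight integrals, which stand on the left of the
    bounds.\<close>
  have closure: "\<exists>Q'\<in>cubes. Q \<subseteq> Q' \<and> measure lebesgue Q' = measure lebesgue Q \<and>
      (LINT x:Q|lebesgue. \<sigma> x) \<le> (LINT x:Q'|lebesgue. \<sigma> x) \<and> (LINT x:Q|lebesgue. u x) \<le> (LINT x:Q'|lebesgue. u x)"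
    if Q: "Q \<in> S" for Q
  proof -
    obtain Q' where Q': "Q' \<in> cubes" "Q \<subseteq> Q'" "measure lebesgue Q' = measure lebesgue Q"
      using S(2)[OF Q] dcube_subset_cube by metis
    with Sm[OF Q] cube_facts[OF Q'(1)] show ?thesis
      by (intro bexI[of _ Q']) (auto intro!: set_integral_weight_mono \<sigma> u)
  qed
  have nonneg: "0 \<le> (LINT x:A|lebesgue. \<sigma> x)" "0 \<le> (LINT x:A|lebesgue. u x)" for A
    by (rule set_integral_nonneg', rule weight_nonneg, rule \<sigma> u)+
  interpret laminar_system lebesgue \<sigma>B uB S "measure lebesgue" a b \<kappa> K c1 c2
  proof
    show "integrable lebesgue \<sigma>B" "integrable lebesgue uB"
      using weight_set_integrable[OF \<sigma> B(2,1)] weight_set_integrable[OF u B(2,1)]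
      by (auto simp: set_integrable_def \<sigma>B_def[abs_def] uB_def[abs_def])
    show "0 \<le> \<sigma>B x" "0 \<le> uB x" for x
      using weight_nonneg[OF \<sigma>] weight_nonneg[OF u] by (auto simp: \<sigma>B_def uB_def)
    show "A \<subseteq> A' \<or> A' \<subseteq> A \<or> A \<inter> A' = {}" if A: "A \<in> S" "A' \<in> S" for A A'
    proof -
      obtain k m l m' where "A = dcube t k m" "A' = dcube t l m'" using S(2) A by metis
      then show ?thesis using dcube_nested[of k l t m m'] dcube_nested[of l k t m' m] by (cases "k \<le> l") auto
    qed
    show "2 * measure lebesgue A \<le> measure lebesgue A'" if A: "A \<in> S" "A' \<in> S" "A \<subset> A'" for A A'
    proof -
      obtain k m l m' where eq: "A = dcube t k m" "A' = dcube t l m'" using S(2) A by metis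
      have "A \<noteq> {}" using Sm(3)[OF A(1)] by auto
      \<comment> \<open>Proper inclusion forces a strictly larger scale, hence a factor of at least
        2 in volume.\<close>
      then have "k < l" using dcube_nested[of l k t m' m] A(3) eq by (cases "l \<le> k") auto
      then have "real CARD('n) * 1 \<le> real CARD('n) * (real_of_int l - real_of_int k)"
        by (intro mult_left_mono) auto
      then have "real CARD('n) + real_of_int k * real CARD('n) \<le> real_of_int l * real CARD('n)"
        by (simp add: algebra_simps)
      moreover have "1 \<le> real CARD('n)" by (simp add: Suc_le_eq)
      ultimately have "1 + real_of_int k * real CARD('n) \<le> real_of_int l * real CARD('n)" by linarith
      then have "2 powr (1 + real_of_int k * real CARD('n)) \<le> 2 powr (real_of_int l * real CARD('n))"
        by (intro powr_mono) auto
      then show ?thesis by (simp add: eq measure_dcube powr_add)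
    qed
    fix Q R and k :: nat
    assume Q: "Q \<in> S" and R: "R \<in> S" "R \<subseteq> Q" "2 ^ k * measure lebesgue R \<le> measure lebesgue Q"
    obtain Q' where Q': "Q' \<in> cubes" "Q \<subseteq> Q'" "measure lebesgue Q' = measure lebesgue Q"
      "(LINT x:Q|lebesgue. \<sigma> x) \<le> (LINT x:Q'|lebesgue. \<sigma> x)" "(LINT x:Q|lebesgue. u x) \<le> (LINT x:Q'|lebesgue. u x)"
      using closure[OF Q] by blast
    have "measure lebesgue Q powr (- \<kappa>) * (LINT x:Q|lebesgue. \<sigma> x) powr (1 - a) * (LINT x:R|lebesgue. u x) powr b \<le>
        measure lebesgue Q' powr (- \<kappa>) * (LINT x:Q'|lebesgue. \<sigma> x) powr (1 - a) * (LINT x:R|lebesgue. u x) powr b"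
      unfolding Q'(3) using Q'(4) nonneg ab by (intro mult_right_mono mult_left_mono powr_mono2) auto
    also have "\<dots> \<le> c1 k" using Q' R Sm[OF R(1)] by (intro tail1) auto
    finally show "measure lebesgue Q powr (- \<kappa>) * (LINT x:Q|lebesgue. \<sigma>B x) powr (1 - a) * (LINT x:R|lebesgue. uB x) powr b \<le> c1 k"
      by (simp only: \<sigma>B[OF Q] uB[OF R(1)])
    have "measure lebesgue Q powr (- \<kappa>) * (LINT x:Q|lebesgue. u x) powr b * (LINT x:R|lebesgue. \<sigma> x) powr (1 - a) \<le>
        measure lebesgue Q' powr (- \<kappa>) * (LINT x:Q'|lebesgue. u x) powr b * (LINT x:R|lebesgue. \<sigma> x) powr (1 - a)"
      unfolding Q'(3) using Q'(5) nonneg ab by (intro mult_right_mono mult_left_mono powr_mono2) auto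
    also have "\<dots> \<le> c2 k" using Q' R Sm[OF R(1)] by (intro tail2) auto
    finally show "measure lebesgue Q powr (- \<kappa>) * (LINT x:Q|lebesgue. uB x) powr b * (LINT x:R|lebesgue. \<sigma>B x) powr (1 - a) \<le> c2 k"
      by (simp only: uB[OF Q] \<sigma>B[OF R(1)])
  qed (use ab \<kappa> K S Sm c1 c2 in auto)
  have TB: "(\<Sum>Q\<in>S. measure lebesgue Q powr (- \<kappa>) * (LINT y:Q|lebesgue. \<phi> y powr a * \<sigma>B y powr (1 - a)) * indicator Q x) = T x" for x
  proof -
    have "(LINT y:Q|lebesgue. \<phi> y powr a * \<sigma>B y powr (1 - a)) = (LINT y:Q|lebesgue. \<phi> y powr a * \<sigma> y powr (1 - a))"
      if "Q \<in> S" for Q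
      unfolding set_lebesgue_integral_def using that
      by (auto intro!: Bochner_Integration.integral_cong simp: \<sigma>B_def B_def indicator_def)
    then show ?thesis by (simp add: T_def)
  qed
  \<comment> \<open>\<open>T\<close> vanishes outside \<open>B\<close>, so the cut-off of
    \<open>u\<close> is not visible in the conclusion.\<close>
  have TuB: "T x powr (1 / b) * uB x = T x powr (1 / b) * u x" for x
  proof (cases "x \<in> B")
    case False
    then have "T x = 0" by (auto simp: T_def B_def)
    then show ?thesis by simp
  qed (simp add: uB_def)
  show "integrable lebesgue (\<lambda>x. T x powr (1 / b) * u x)"
    using operator_bound(1)[OF \<phi>] by (simp only: TB TuB)
  show "(\<integral>x. T x powr (1 / b) * u x \<partial>lebesgue) \<le>
      (laminar_const a b \<kappa> * K * (\<integral>x. \<phi> x \<partial>lebesgue) powr a) powr (1 / b)"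
    using operator_bound(2)[OF \<phi>] by (simp only: TB TuB)
qed

end

subsection \<open>The Riesz potential\<close>

lemma measurable_riesz_kernel:
  "(\<lambda>z. riesz_kernel \<alpha> (fst z) (snd z)) \<in> borel_measurable (borel \<Otimes>\<^sub>M (borel :: (real ^ 'n) measure))"
  unfolding riesz_kernel_def by measurable

lemma measurable_riesz_kernel_lebesgue:
  "(\<lambda>y. riesz_kernel \<alpha> x y) \<in> borel_measurable lebesgue"
proof (rule measurable_completion)
  show "(\<lambda>y. riesz_kernel \<alpha> x y) \<in> borel_measurable lborel"
    unfolding riesz_kernel_def by measurable
qed

text \<open>Measurability of parameter integrals is applied to a Borel function that agrees with
  \<open>h\<close> almost everywhere. The replacement changes the potential at no point.\<close>

lemma riesz_potential_measurable:
  fixes h :: "real ^ 'n \<Rightarrow> real"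
  assumes h: "h \<in> borel_measurable lebesgue"
  shows "riesz_potential \<alpha> h \<in> borel_measurable lebesgue"
proof -
  obtain h' where h': "h' \<in> borel_measurable lborel" "AE x in lborel. h x = h' x"
    using completion_ex_borel_measurable_real[OF h] by blast
  have [measurable]: "h' \<in> borel_measurable borel" using h'(1) by simp
  have ae: "AE y in lebesgue. h y = h' y" using h'(2) by (rule AE_completion)
  have meas: "(\<lambda>z. h' (snd z) * riesz_kernel \<alpha> (fst z) (snd z)) \<in> borel_measurable (borel \<Otimes>\<^sub>M (borel :: (real ^ 'n) measure))"
    using measurable_riesz_kernel[of \<alpha>] by measurable
  have "riesz_potential \<alpha> h x = (\<integral>y. h' y * riesz_kernel \<alpha> x y \<partial>lborel)" for x
  proof -
    have m: "(\<lambda>y. h' y * riesz_kernel \<alpha> x y) \<in> borel_measurable lborel"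
      unfolding riesz_kernel_def by measurable
    have "riesz_potential \<alpha> h x = (\<integral>y. h' y * riesz_kernel \<alpha> x y \<partial>lebesgue)"
      unfolding riesz_potential_def using ae h h'(1) measurable_riesz_kernel_lebesgue[of \<alpha> x] measurable_completion[OF m]
      by (intro integral_cong_AE) auto
    also have "\<dots> = (\<integral>y. h' y * riesz_kernel \<alpha> x y \<partial>lborel)" by (rule integral_completion[OF m])
    finally show ?thesis .
  qed
  moreover have "(\<lambda>x. \<integral>y. h' y * riesz_kernel \<alpha> x y \<partial>lborel) \<in> borel_measurable borel"
  proof (rule lborel.borel_measurable_lebesgue_integral)
    show "(\<lambda>(x, y). h' y * riesz_kernel \<alpha> x y) \<in> borel_measurable (borel \<Otimes>\<^sub>M lborel)"
      using meas by (simp add: case_prod_beta measurable_cong_sets[OF sets_pair_measure_cong[OF refl sets_lborel] refl])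
  qed
  ultimately have "riesz_potential \<alpha> h \<in> borel_measurable borel" by (simp add: fun_eq_iff cong: measurable_cong)
  then show ?thesis by (intro measurable_completion) simp
qed

context tailed_weights
begin

text \<open>The finite dyadic sums \<open>\<Phi> N\<close> increase in \<open>N\<close> and have
  norm bounds independent of \<open>N\<close>, so monotone convergence carries the bound over to the
  potential of |f| \<sigma>. Its finiteness is the absolute convergence that makes the signed
  potential meaningful.\<close>

theorem riesz_two_weight:
  assumes \<alpha>: "\<alpha> < real CARD('n)" "\<kappa> = 1 - \<alpha> / real CARD('n)"
  shows "\<exists>C::ennreal. C < \<infinity> \<and>
    (\<forall>f \<in> weighted_Lp (1 / a) \<sigma>.
       (AE x in density lebesgue (\<lambda>x. ennreal (u x)). riesz_converges \<alpha> (\<lambda>y. f y * \<sigma> y) x) \<and>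
       riesz_potential \<alpha> (\<lambda>y. f y * \<sigma> y) \<in> weighted_Lp (1 / b) u \<and>
       weighted_norm (1 / b) u (riesz_potential \<alpha> (\<lambda>y. f y * \<sigma> y)) \<le> C * weighted_norm (1 / a) \<sigma> f)"
proof -
  define c where "c = 6 powr (real CARD('n) - \<alpha>)"
  have c: "0 < c" by (simp add: c_def)
  define m where "m = real CARD('n \<Rightarrow> bool)"
  have m: "0 < m" by (simp add: m_def)
  define LK where "LK = laminar_const a b \<kappa> * K"
  have LK: "0 \<le> LK" using laminar_const_nonneg[of b a \<kappa>] ab \<kappa> K by (simp add: LK_def)
  \<comment> \<open>\<open>c\<close> compares the kernel with the cubes and \<open>m\<close> counts
    the grids. One factor \<open>m\<close> comes from \<open>sum_powr_le\<close>, the factor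
    \<open>m powr b\<close> from adding \<open>m\<close> equal bounds under the power
    \<open>1 / b\<close>.\<close>
  define C where "C = m powr b * (c * m) * LK"
  have C: "0 \<le> C" using c m LK by (simp add: C_def)
  have a0: "0 < a" using ab by simp
  note [measurable] = weight_measurable[OF \<sigma>] weight_measurable[OF u]
  have u0: "0 \<le> u x" and \<sigma>0: "0 \<le> \<sigma> x" for x by (rule weight_nonneg, rule u \<sigma>)+
  have main: "(AE x in density lebesgue (\<lambda>x. ennreal (u x)). riesz_converges \<alpha> (\<lambda>y. f y * \<sigma> y) x) \<and>
       riesz_potential \<alpha> (\<lambda>y. f y * \<sigma> y) \<in> weighted_Lp (1 / b) u \<and>
       weighted_norm (1 / b) u (riesz_potential \<alpha> (\<lambda>y. f y * \<sigma> y)) \<le> ennreal C * weighted_norm (1 / a) \<sigma> f"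
    if f: "f \<in> weighted_Lp (1 / a) \<sigma>" for f
  proof -
    have [measurable]: "f \<in> borel_measurable lebesgue" using f by (simp add: weighted_Lp_def)
    define \<phi> where "\<phi> x = \<bar>f x\<bar> powr (1 / a) * \<sigma> x" for x
    have \<phi>0: "0 \<le> \<phi> x" for x using \<sigma>0 by (simp add: \<phi>_def)
    have \<phi>int: "integrable lebesgue \<phi>"
    proof (rule integrableI_nonneg)
      show "\<phi> \<in> borel_measurable lebesgue" unfolding \<phi>_def[abs_def] by measurable
      show "(\<integral>\<^sup>+x. ennreal (\<phi> x) \<partial>lebesgue) < \<infinity>"
        using f unfolding weighted_Lp_def weighted_norm_def \<phi>_def epowr_def by (auto simp: less_top split: if_splits)
    qed (use \<phi>0 in auto)
    define F where "F = (\<integral>x. \<phi> x \<partial>lebesgue)"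
    have F0: "0 \<le> F" using \<phi>0 by (simp add: F_def)
    have normf: "weighted_norm (1 / a) \<sigma> f = ennreal (F powr a)"
    proof -
      have "(\<integral>\<^sup>+x. ennreal (\<phi> x) \<partial>lebesgue) = ennreal F"
        unfolding F_def using \<phi>int \<phi>0 by (intro nn_integral_eq_integral) auto
      then show ?thesis using F0 by (simp add: weighted_norm_def epowr_def \<phi>_def[symmetric])
    qed
    define h where "h x = \<bar>f x\<bar> * \<sigma> x" for x
    have h0: "0 \<le> h x" for x using \<sigma>0 by (simp add: h_def)
    have [measurable]: "h \<in> borel_measurable lebesgue" unfolding h_def[abs_def] by measurable
    have h\<phi>: "\<phi> x powr a * \<sigma> x powr (1 - a) = h x" for x
    proof -
      have "\<phi> x powr a * \<sigma> x powr (1 - a) = \<bar>f x\<bar> * (\<sigma> x powr a * \<sigma> x powr (1 - a))"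
        using a0 \<sigma>0[of x] by (simp add: \<phi>_def powr_mult powr_powr)
      also have "\<sigma> x powr a * \<sigma> x powr (1 - a) = \<sigma> x" using \<sigma>0[of x] by (simp add: powr_add[symmetric])
      finally show ?thesis by (simp add: h_def)
    qed
    have hint: "integrable lebesgue (\<lambda>y. indicator Q y * h y)" if "Q \<in> sets lebesgue" "bounded Q" for Q
    proof -
      have "integrable lebesgue (\<lambda>x. (indicator Q x * \<phi> x) powr a * (indicator Q x * \<sigma> x) powr (1 - a))"
        using weight_set_integrable[OF \<sigma> that(2,1)] \<phi>int \<phi>0 \<sigma>0 that ab
        by (intro integral_powr_mult_powr) (auto simp: set_integrable_def mult.commute[of "indicator _ _" "\<phi> _"] intro: integrable_real_mult_indicator)
      moreover have "(indicator Q x * \<phi> x) powr a * (indicator Q x * \<sigma> x) powr (1 - a) = indicator Q x * h x" for x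
        by (simp add: h\<phi> indicator_def)
      ultimately show ?thesis by simp
    qed
    define T where "T t N x = (\<Sum>Q\<in>dgrid t N. measure lebesgue Q powr (- \<kappa>) *
        (LINT y:Q|lebesgue. h y) * indicator Q x)" for t :: "'n \<Rightarrow> bool" and N and x :: "real ^ 'n"
    define \<Phi> where "\<Phi> N x = c * (\<Sum>t\<in>UNIV. T t N x)" for N x
    have gm: "Q \<in> sets lebesgue" "bounded Q" if "Q \<in> dgrid t N" for Q :: "(real ^ 'n) set" and t N
      using dgrid_dcube[OF that] by (auto simp: dcube_lebesgue dcube_bounded)
    have T0: "0 \<le> T t N x" for t N x
      unfolding T_def using h0 by (intro sum_nonneg mult_nonneg_nonneg set_integral_nonneg') auto
    have Tmono: "T t N x \<le> T t N' x" if "N \<le> N'" for t N N' x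
      unfolding T_def using h0 dgrid_mono[OF that, of t] finite_dgrid
      by (intro sum_mono2) (auto intro!: mult_nonneg_nonneg set_integral_nonneg')
    have \<Phi>0: "0 \<le> \<Phi> N x" for N x unfolding \<Phi>_def using c T0 by (intro mult_nonneg_nonneg sum_nonneg) auto
    have \<Phi>mono: "\<Phi> N x \<le> \<Phi> N' x" if "N \<le> N'" for N N' x
      unfolding \<Phi>_def using c Tmono[OF that] by (intro mult_left_mono sum_mono) auto
    have [measurable]: "T t N \<in> borel_measurable lebesgue" for t N
      unfolding T_def[abs_def]
    proof (rule borel_measurable_sum)
      fix Q assume "Q \<in> dgrid t N"
      then have [measurable]: "Q \<in> sets lebesgue" by (rule gm)
      show "(\<lambda>x. measure lebesgue Q powr (- \<kappa>) * (LINT y:Q|lebesgue. h y) * indicator Q x) \<in> borel_measurable lebesgue"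
        by measurable
    qed
    have [measurable]: "\<Phi> N \<in> borel_measurable lebesgue" for N unfolding \<Phi>_def[abs_def] by measurable
    have Tint: "integrable lebesgue (\<lambda>x. T t N x powr (1 / b) * u x)"
      and Tbound: "(\<integral>x. T t N x powr (1 / b) * u x \<partial>lebesgue) \<le> (LK * F powr a) powr (1 / b)" for t N
      using dyadic_bound[OF finite_dgrid dgrid_dcube \<phi>int \<phi>0, where t3 = t and N3 = N]
      unfolding h\<phi> T_def F_def LK_def by auto
    define D where "D = m * ((c * m) powr (1 / b) * (LK * F powr a) powr (1 / b))"
    have \<Phi>bound: "(\<integral>\<^sup>+x. ennreal (\<Phi> N x powr (1 / b) * u x) \<partial>lebesgue) \<le> ennreal D" for N
    proof -
      have int: "integrable lebesgue (\<lambda>x. \<Sum>t\<in>UNIV. (c * m) powr (1 / b) * (T t N x powr (1 / b) * u x))"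
        using Tint by auto
      have le: "\<Phi> N x powr (1 / b) * u x \<le> (\<Sum>t\<in>UNIV. (c * m) powr (1 / b) * (T t N x powr (1 / b) * u x))" for x
      proof -
        have "\<Phi> N x powr (1 / b) = c powr (1 / b) * (\<Sum>t\<in>UNIV. T t N x) powr (1 / b)"
          using c T0 by (simp add: \<Phi>_def powr_mult sum_nonneg)
        also have "\<dots> \<le> c powr (1 / b) * (\<Sum>t\<in>(UNIV :: ('n \<Rightarrow> bool) set). (m * T t N x) powr (1 / b))"
          unfolding m_def using T0 ab by (intro mult_left_mono sum_powr_le) auto
        also have "\<dots> = (\<Sum>t\<in>UNIV. (c * m) powr (1 / b) * T t N x powr (1 / b))"
          using c m T0 by (simp add: sum_distrib_left powr_mult mult_ac)
        finally have "\<Phi> N x powr (1 / b) * u x \<le> (\<Sum>t\<in>UNIV. (c * m) powr (1 / b) * T t N x powr (1 / b)) * u x"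
          using u0 by (rule mult_right_mono)
        then show ?thesis by (simp add: sum_distrib_right mult.assoc)
      qed
      have "(\<integral>\<^sup>+x. ennreal (\<Phi> N x powr (1 / b) * u x) \<partial>lebesgue) \<le>
          (\<integral>\<^sup>+x. ennreal (\<Sum>t\<in>UNIV. (c * m) powr (1 / b) * (T t N x powr (1 / b) * u x)) \<partial>lebesgue)"
        using le by (intro nn_integral_mono ennreal_leI)
      also have "\<dots> = ennreal (\<integral>x. (\<Sum>t\<in>UNIV. (c * m) powr (1 / b) * (T t N x powr (1 / b) * u x)) \<partial>lebesgue)"
        using int u0 T0 by (intro nn_integral_eq_integral) (auto intro!: AE_I2 sum_nonneg)
      also have "(\<integral>x. (\<Sum>t\<in>UNIV. (c * m) powr (1 / b) * (T t N x powr (1 / b) * u x)) \<partial>lebesgue) =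
          (\<Sum>t\<in>UNIV. (c * m) powr (1 / b) * (\<integral>x. T t N x powr (1 / b) * u x \<partial>lebesgue))"
        using Tint by (subst Bochner_Integration.integral_sum) auto
      also have "\<dots> \<le> (\<Sum>t\<in>(UNIV :: ('n \<Rightarrow> bool) set). (c * m) powr (1 / b) * (LK * F powr a) powr (1 / b))"
        by (intro sum_mono mult_left_mono Tbound) auto
      also have "\<dots> = D" by (simp add: D_def m_def)
      finally show ?thesis by (simp add: ennreal_leI)
    qed
    \<comment> \<open>The supremum is taken with power and weight inside, so that its integral
      inherits the bound \<open>D\<close> and \<open>G\<close> is finite almost everywhere.\<close>
    define G where "G x = (SUP N. ennreal (\<Phi> N x powr (1 / b) * u x))" for x
    have [measurable]: "G \<in> borel_measurable lebesgue" unfolding G_def[abs_def] by measurable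
    have Gint: "(\<integral>\<^sup>+x. G x \<partial>lebesgue) \<le> ennreal D"
    proof -
      have "(\<integral>\<^sup>+x. G x \<partial>lebesgue) = (SUP N. \<integral>\<^sup>+x. ennreal (\<Phi> N x powr (1 / b) * u x) \<partial>lebesgue)"
        unfolding G_def
      proof (rule nn_integral_monotone_convergence_SUP)
        show "incseq (\<lambda>N x. ennreal (\<Phi> N x powr (1 / b) * u x))"
          unfolding incseq_def le_fun_def using \<Phi>mono \<Phi>0 u0 ab
          by (auto intro!: ennreal_leI mult_right_mono powr_mono2)
      qed measurable
      also have "\<dots> \<le> ennreal D" by (intro SUP_least \<Phi>bound)
      finally show ?thesis .
    qed
    have AEG: "AE x in lebesgue. G x \<noteq> \<infinity>"
      using Gint by (intro nn_integral_PInf_AE) (auto simp: top_unique)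
    have pot: "(\<integral>\<^sup>+y. ennreal (h y * riesz_kernel \<alpha> x y) \<partial>lebesgue) \<le> (SUP N. ennreal (\<Phi> N x))" for x
    proof -
      define k where "k N y = c * (\<Sum>t\<in>UNIV. \<Sum>Q\<in>dgrid t N. measure lebesgue Q powr (- \<kappa>) * indicator Q x * indicator Q y)"
        for N and y :: "real ^ 'n"
      have kmono: "k N y \<le> k N' y" if "N \<le> N'" for N N' y
        unfolding k_def using c dgrid_mono[OF that] finite_dgrid
        by (intro mult_left_mono sum_mono sum_mono2) auto
      have hk: "h y * k N y = (\<Sum>t\<in>UNIV. \<Sum>Q\<in>dgrid t N. (c * measure lebesgue Q powr (- \<kappa>) * indicator Q x) * (indicator Q y * h y))" for N y
        by (simp add: k_def sum_distrib_left mult_ac)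
      have hkint: "integrable lebesgue (\<lambda>y. h y * k N y)" for N
        unfolding hk using hint gm by (intro Bochner_Integration.integrable_sum Bochner_Integration.integrable_mult_right) auto
      have hk\<Phi>: "(\<integral>y. h y * k N y \<partial>lebesgue) = \<Phi> N x" for N
        unfolding hk using hint gm
        by (subst Bochner_Integration.integral_sum Bochner_Integration.integral_mult_right_zero,
            (intro Bochner_Integration.integrable_sum Bochner_Integration.integrable_mult_right; auto)?)+
          (simp add: \<Phi>_def T_def set_lebesgue_integral_def sum_distrib_left mult_ac)
      have k0: "0 \<le> k N y" for N y unfolding k_def using c by (intro mult_nonneg_nonneg sum_nonneg) auto
      have [measurable]: "(\<lambda>y. h y * k N y) \<in> borel_measurable lebesgue" for N using hkint by auto
      have "(\<integral>\<^sup>+y. ennreal (h y * riesz_kernel \<alpha> x y) \<partial>lebesgue) \<le> (\<integral>\<^sup>+y. (SUP N. ennreal (h y * k N y)) \<partial>lebesgue)"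
      proof (intro nn_integral_mono)
        \<comment> \<open>The index \<open>N\<close> at which the dyadic kernel dominates depends on
          \<open>y\<close>; only the supremum dominates everywhere, and monotone convergence moves
          it out of the integral.\<close>
        fix y
        obtain N where "riesz_kernel \<alpha> x y \<le> k N y"
          using riesz_kernel_dyadic[OF \<alpha>(1), of x y] unfolding k_def c_def \<alpha>(2) by blast
        then have "ennreal (h y * riesz_kernel \<alpha> x y) \<le> ennreal (h y * k N y)"
          using h0 by (intro ennreal_leI mult_left_mono)
        also have "\<dots> \<le> (SUP N. ennreal (h y * k N y))" by (rule SUP_upper) simp
        finally show "ennreal (h y * riesz_kernel \<alpha> x y) \<le> (SUP N. ennreal (h y * k N y))" .
      qed
      also have "\<dots> = (SUP N. \<integral>\<^sup>+y. ennreal (h y * k N y) \<partial>lebesgue)"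
      proof (rule nn_integral_monotone_convergence_SUP)
        show "incseq (\<lambda>N y. ennreal (h y * k N y))"
          unfolding incseq_def le_fun_def using kmono h0 by (auto intro!: ennreal_leI mult_left_mono)
      qed measurable
      also have "\<dots> = (SUP N. ennreal (\<Phi> N x))"
        using hkint h0 k0 by (intro SUP_cong refl, subst nn_integral_eq_integral) (auto simp: hk\<Phi>)
      finally show ?thesis .
    qed
    \<comment> \<open>Where \<open>u x\<close> is positive, division by it recovers a bound for all
      \<open>\<Phi> N x\<close>. The zeros of \<open>u\<close> are null for the measure with density
      \<open>u\<close>.\<close>
    have point: "riesz_converges \<alpha> (\<lambda>y. f y * \<sigma> y) x \<and>
        ennreal (\<bar>riesz_potential \<alpha> (\<lambda>y. f y * \<sigma> y) x\<bar> powr (1 / b) * u x) \<le> G x"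
      if G: "G x \<noteq> \<infinity>" and ux: "0 < u x" for x
    proof -
      define B where "B = enn2real (G x)"
      have GB: "G x = ennreal B" using G by (simp add: B_def less_top)
      have B0: "0 \<le> B" by (simp add: B_def)
      define L where "L = (B / u x) powr b"
      have "\<Phi> N x \<le> L" for N
      proof -
        have "ennreal (\<Phi> N x powr (1 / b) * u x) \<le> ennreal B"
          unfolding GB[symmetric] G_def by (rule SUP_upper) simp
        then have "\<Phi> N x powr (1 / b) \<le> B / u x" using B0 ux by (simp add: pos_le_divide_eq)
        then have "(\<Phi> N x powr (1 / b)) powr b \<le> L" unfolding L_def using ab by (intro powr_mono2) auto
        then show ?thesis using \<Phi>0[of N x] ab by (simp add: powr_powr)
      qed
      then have "(SUP N. ennreal (\<Phi> N x)) \<le> ennreal L" by (intro SUP_least ennreal_leI)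
      with pot[of x] have le: "(\<integral>\<^sup>+y. ennreal (h y * riesz_kernel \<alpha> x y) \<partial>lebesgue) \<le> ennreal L" by (rule order_trans)
      have k0: "0 \<le> riesz_kernel \<alpha> x y" for y by (simp add: riesz_kernel_def)
      have nrm: "norm (f y * \<sigma> y * riesz_kernel \<alpha> x y) = h y * riesz_kernel \<alpha> x y" for y
        using \<sigma>0[of y] k0[of y] by (simp add: h_def abs_mult)
      have [measurable]: "(\<lambda>y. riesz_kernel \<alpha> x y) \<in> borel_measurable lebesgue" by (rule measurable_riesz_kernel_lebesgue)
      have int: "integrable lebesgue (\<lambda>y. f y * \<sigma> y * riesz_kernel \<alpha> x y)"
      proof (rule integrableI_bounded)
        show "(\<integral>\<^sup>+y. ennreal (norm (f y * \<sigma> y * riesz_kernel \<alpha> x y)) \<partial>lebesgue) < \<infinity>"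
          unfolding nrm using le by (auto intro: le_less_trans)
      qed measurable
      have "ennreal (norm (riesz_potential \<alpha> (\<lambda>y. f y * \<sigma> y) x)) \<le> (\<integral>\<^sup>+y. ennreal (norm (f y * \<sigma> y * riesz_kernel \<alpha> x y)) \<partial>lebesgue)"
        unfolding riesz_potential_def by (rule integral_norm_bound_ennreal[OF int])
      also have "\<dots> \<le> ennreal L" unfolding nrm by (rule le)
      finally have "\<bar>riesz_potential \<alpha> (\<lambda>y. f y * \<sigma> y) x\<bar> \<le> L" by (simp add: L_def)
      then have "\<bar>riesz_potential \<alpha> (\<lambda>y. f y * \<sigma> y) x\<bar> powr (1 / b) * u x \<le> L powr (1 / b) * u x"
        using ab ux by (intro mult_right_mono powr_mono2) auto
      also have "\<dots> = B" using ab ux B0 by (simp add: L_def powr_powr)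
      finally have "ennreal (\<bar>riesz_potential \<alpha> (\<lambda>y. f y * \<sigma> y) x\<bar> powr (1 / b) * u x) \<le> G x"
        unfolding GB by (rule ennreal_leI)
      with int show ?thesis by (simp add: riesz_converges_def)
    qed
    have conv: "AE x in density lebesgue (\<lambda>x. ennreal (u x)). riesz_converges \<alpha> (\<lambda>y. f y * \<sigma> y) x"
    proof (subst AE_density)
      show "AE x in lebesgue. 0 < ennreal (u x) \<longrightarrow> riesz_converges \<alpha> (\<lambda>y. f y * \<sigma> y) x"
        using AEG by eventually_elim (use point in auto)
    qed measurable
    define I where "I = (\<integral>\<^sup>+x. ennreal (\<bar>riesz_potential \<alpha> (\<lambda>y. f y * \<sigma> y) x\<bar> powr (1 / b) * u x) \<partial>lebesgue)"
    have IG: "I \<le> (\<integral>\<^sup>+x. G x \<partial>lebesgue)"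
      unfolding I_def
    proof (rule nn_integral_mono_AE)
      show "AE x in lebesgue. ennreal (\<bar>riesz_potential \<alpha> (\<lambda>y. f y * \<sigma> y) x\<bar> powr (1 / b) * u x) \<le> G x"
        using AEG
      proof eventually_elim
        case (elim x)
        then show ?case using point[of x] u0[of x] by (cases "u x = 0") auto
      qed
    qed
    from IG Gint have ID: "I \<le> ennreal D" by (rule order_trans)
    have D0: "0 \<le> D" using m by (simp add: D_def)
    have "weighted_norm (1 / b) u (riesz_potential \<alpha> (\<lambda>y. f y * \<sigma> y)) \<le> ennreal (D powr b)"
    proof -
      have "I < \<infinity>" using ID by (auto intro: le_less_trans)
      then obtain r where r: "I = ennreal r" "0 \<le> r" by (cases I) auto
      then have "r \<le> D" using ID D0 by simp
      then have "r powr b \<le> D powr b" using r ab by (intro powr_mono2) auto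
      then show ?thesis using r by (simp add: weighted_norm_def I_def[symmetric] epowr_def ennreal_leI)
    qed
    also have "D powr b = C * F powr a"
      using ab m c LK F0 by (simp add: D_def C_def powr_mult powr_powr)
    also have "ennreal (C * F powr a) = ennreal C * weighted_norm (1 / a) \<sigma> f"
      unfolding normf using C by (intro ennreal_mult) auto
    finally have bound: "weighted_norm (1 / b) u (riesz_potential \<alpha> (\<lambda>y. f y * \<sigma> y)) \<le> ennreal C * weighted_norm (1 / a) \<sigma> f" .
    moreover have "riesz_potential \<alpha> (\<lambda>y. f y * \<sigma> y) \<in> weighted_Lp (1 / b) u"
      unfolding weighted_Lp_def
    proof (intro CollectI conjI)
      show "riesz_potential \<alpha> (\<lambda>y. f y * \<sigma> y) \<in> borel_measurable lebesgue"
        by (intro riesz_potential_measurable) measurable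
      have "ennreal C * weighted_norm (1 / a) \<sigma> f < \<infinity>" unfolding normf by (simp add: ennreal_mult_less_top)
      with bound show "weighted_norm (1 / b) u (riesz_potential \<alpha> (\<lambda>y. f y * \<sigma> y)) < \<infinity>" by (rule le_less_trans)
    qed
    ultimately show ?thesis using conv by blast
  qed
  show ?thesis by (intro exI[of _ "ennreal C"] conjI ballI main) auto
qed

end

section \<open>From the bump conditions to summable tails\<close>

theorem theorem1p14:
  fixes \<alpha> p q \<delta> :: real
    and u \<sigma> :: "real ^ 'n \<Rightarrow> real"
  assumes "0 < \<alpha>" and "\<alpha> < real CARD('n)"
    and "1 < p" and "p \<le> q"
    and "min (q / p) (conj_exp p / conj_exp q) * (1 - \<alpha> / real CARD('n)) \<ge> 1"
    and "0 < \<delta>"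
    and "weight u" and "weight \<sigma>"
    and "(SUP Q\<in>cubes.
            ennreal (measure lebesgue Q powr (\<alpha> / real CARD('n) + 1 / q - 1 / p))
            * luxemburg_norm (log_bump q \<delta>) Q (\<lambda>x. u x powr (1 / q))
            * local_norm (conj_exp p) Q (\<lambda>x. \<sigma> x powr (1 / conj_exp p))) < \<infinity>"
    and "(SUP Q\<in>cubes.
            ennreal (measure lebesgue Q powr (\<alpha> / real CARD('n) + 1 / q - 1 / p))
            * local_norm q Q (\<lambda>x. u x powr (1 / q))
            * luxemburg_norm (log_bump (conj_exp p) \<delta>) Q (\<lambda>x. \<sigma> x powr (1 / conj_exp p))) < \<infinity>"
  shows "\<exists>C::ennreal. C < \<infinity> \<and>
    (\<forall>f \<in> weighted_Lp p \<sigma>.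
       (AE x in density lebesgue (\<lambda>x. ennreal (u x)). riesz_converges \<alpha> (\<lambda>y. f y * \<sigma> y) x) \<and>
       riesz_potential \<alpha> (\<lambda>y. f y * \<sigma> y) \<in> weighted_Lp q u \<and>
       weighted_norm q u (riesz_potential \<alpha> (\<lambda>y. f y * \<sigma> y)) \<le> C * weighted_norm p \<sigma> f)"
proof -
  let ?n = "real CARD('n)"
  define \<kappa> where "\<kappa> = 1 - \<alpha> / ?n"
  have \<kappa>: "0 < \<kappa>" "\<kappa> < 1" using assms(1,2) by (auto simp: \<kappa>_def)
  have p: "1 < p" by fact
  have pq: "p < q"
  proof -
    \<comment> \<open>Since \<kappa> < 1, the hypothesis gives 1 \<le> (q / p) \<kappa> < q /
      p.\<close>
    have "min (q / p) (conj_exp p / conj_exp q) * \<kappa> \<le> q / p * \<kappa>" using \<kappa> by (intro mult_right_mono) auto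
    also have "q / p * \<kappa> < q / p * 1" using \<kappa> p assms(4) by (intro mult_strict_left_mono) auto
    finally have "1 < q / p" using assms(5) by (simp add: \<kappa>_def)
    then show ?thesis using p by (simp add: less_divide_eq)
  qed
  define p' where "p' = conj_exp p"
  have p': "1 < p'" "1 / p' = 1 - 1 / p" "p' - 1 = 1 / (p - 1)"
    using p by (auto simp: p'_def conj_exp_def field_simps)
  have ab: "0 < 1 / q" "1 / q < 1 / p" "1 / p < 1" using p pq by (auto simp: field_simps)
  obtain K1 where K1: "0 \<le> K1" "\<And>Q. Q \<in> cubes \<Longrightarrow>
      ennreal (measure lebesgue Q powr (\<alpha> / ?n + 1 / q - 1 / p))
            * luxemburg_norm (log_bump q \<delta>) Q (\<lambda>x. u x powr (1 / q))
            * local_norm p' Q (\<lambda>x. \<sigma> x powr (1 / p')) \<le> ennreal K1"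
  proof -
    obtain r where r: "0 \<le> r" "(SUP Q\<in>cubes. ennreal (measure lebesgue Q powr (\<alpha> / ?n + 1 / q - 1 / p))
            * luxemburg_norm (log_bump q \<delta>) Q (\<lambda>x. u x powr (1 / q))
            * local_norm p' Q (\<lambda>x. \<sigma> x powr (1 / p'))) = ennreal r"
      using assms(9) unfolding p'_def[symmetric] by (auto simp: less_top_ennreal)
    show ?thesis by (rule that[OF r(1)], unfold r(2)[symmetric]) (rule SUP_upper)
  qed
  obtain K2 where K2: "0 \<le> K2" "\<And>Q. Q \<in> cubes \<Longrightarrow>
      ennreal (measure lebesgue Q powr (\<alpha> / ?n + 1 / q - 1 / p))
            * luxemburg_norm (log_bump p' \<delta>) Q (\<lambda>x. \<sigma> x powr (1 / p'))
            * local_norm q Q (\<lambda>x. u x powr (1 / q)) \<le> ennreal K2"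
  proof -
    obtain r where r: "0 \<le> r" "(SUP Q\<in>cubes. ennreal (measure lebesgue Q powr (\<alpha> / ?n + 1 / q - 1 / p))
            * local_norm q Q (\<lambda>x. u x powr (1 / q))
            * luxemburg_norm (log_bump p' \<delta>) Q (\<lambda>x. \<sigma> x powr (1 / p'))) = ennreal r"
      using assms(10) unfolding p'_def[symmetric] by (auto simp: less_top_ennreal)
    \<comment> \<open>The last two factors are exchanged to match the shape of
      \<open>bump_condition_tail\<close>, where the Luxemburg norm stands first.\<close>
    show ?thesis
      by (rule that[OF r(1)], unfold r(2)[symmetric] mult.assoc, subst (2) mult.commute) (rule SUP_upper)
  qed
  define d1 where "d1 k = bump_decay q (q - 1 + \<delta>) k" for k
  define d2 where "d2 k = bump_decay p' (p' - 1 + \<delta>) k" for k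
  have s1: "summable (\<lambda>k. d1 k powr (1 / q * (1 / (1 - 1 / p))))"
    unfolding d1_def
  proof (rule summable_bump_decay)
    \<comment> \<open>The terms decay with exponent (q - 1 + \<delta>) p' / q, which exceeds 1
      because 1 - 1/q > 1/p'.\<close>
    have "1 - 1 / p < 1 - 1 / q" using ab by simp
    also have "\<dots> \<le> (q - 1 + \<delta>) * (1 / q)" using p pq assms(6) by (simp add: field_simps)
    finally have "1 < (q - 1 + \<delta>) * (1 / q) / (1 - 1 / p)" using ab by (subst pos_less_divide_eq) auto
    then show "1 < (q - 1 + \<delta>) * (1 / q * (1 / (1 - 1 / p)))" by simp
  qed (use p pq assms(6) ab in auto)
  have s2: "summable (\<lambda>k. d2 k powr ((1 - 1 / p) * (1 / (1 / q))))"
    unfolding d2_def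
  proof (rule summable_bump_decay)
    \<comment> \<open>Here the exponent is (p' - 1 + \<delta>) q / p', and (p' - 1) q / p' equals q
      / p > 1.\<close>
    have "1 - 1 / p = (p - 1) / p" using p by (simp add: field_simps)
    then have "(p' - 1) * ((1 - 1 / p) * q) = q / p" using p by (simp add: p'(3))
    then have "1 < (p' - 1) * ((1 - 1 / p) * q)" using p pq by (simp add: less_divide_eq)
    also have "\<dots> \<le> (p' - 1 + \<delta>) * ((1 - 1 / p) * q)"
      using ab p pq assms(6) by (intro mult_right_mono) auto
    finally show "1 < (p' - 1 + \<delta>) * ((1 - 1 / p) * (1 / (1 / q)))" by simp
  qed (use p pq p' assms(6) ab in auto)
  have scaled: "\<exists>K\<ge>0. \<forall>n. (\<Sum>k<n. (K0 * d k powr e') powr e) \<le> K powr e"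
    if "summable (\<lambda>k. d k powr (e' * e))" "0 \<le> K0" "0 < e" for d :: "nat \<Rightarrow> real" and K0 e e'
  proof -
    define Z where "Z = (\<Sum>k. d k powr (e' * e))"
    have Z: "0 \<le> Z" using that by (auto simp: Z_def intro!: suminf_nonneg)
    show ?thesis
    proof (intro exI[of _ "K0 * Z powr (1 / e)"] conjI allI)
      fix n
      have "(\<Sum>k<n. (K0 * d k powr e') powr e) = K0 powr e * (\<Sum>k<n. d k powr (e' * e))"
        using that by (simp add: powr_mult powr_powr sum_distrib_left)
      also have "\<dots> \<le> K0 powr e * Z"
        unfolding Z_def using that by (intro mult_left_mono sum_le_suminf) auto
      also have "\<dots> = (K0 * Z powr (1 / e)) powr e" using that Z by (simp add: powr_mult powr_powr)
      finally show "(\<Sum>k<n. (K0 * d k powr e') powr e) \<le> (K0 * Z powr (1 / e)) powr e" .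
    qed (use that in auto)
  qed
  obtain K3 where K3: "0 \<le> K3" "\<And>n. (\<Sum>k<n. (K1 * d1 k powr (1 / q)) powr (1 / (1 - 1 / p))) \<le> K3 powr (1 / (1 - 1 / p))"
    using scaled[OF s1 K1(1)] ab by auto
  obtain K4 where K4: "0 \<le> K4" "\<And>n. (\<Sum>k<n. (K2 * d2 k powr (1 - 1 / p)) powr (1 / (1 / q))) \<le> K4 powr (1 / (1 / q))"
    using scaled[OF s2 K2(1)] ab by auto
  \<comment> \<open>Since 1/p + 1/p' = 1, the measure of the cube enters both bounds with exponent
    \<alpha>/n - 1.\<close>
  have exponent: "\<alpha> / ?n + 1 / q - 1 / p - 1 / q - 1 / p' = - \<kappa>" "\<alpha> / ?n + 1 / q - 1 / p - 1 / p' - 1 / q = - \<kappa>"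
    by (simp_all add: p'(2) \<kappa>_def)
  have pos: "1 \<le> q" "0 < q - 1 + \<delta>" "0 < p'" "1 \<le> p'" "0 < p' - 1 + \<delta>" "0 < q"
    using p pq p'(1) assms(6) by auto
  \<comment> \<open>The two series are bounded with different constants; their maximum serves for
    both.\<close>
  interpret tailed_weights \<sigma> u "1 / p" "1 / q" \<kappa> "max K3 K4" "\<lambda>k. K1 * d1 k powr (1 / q)" "\<lambda>k. K2 * d2 k powr (1 - 1 / p)"
  proof
    show "(\<Sum>k<n. (K1 * d1 k powr (1 / q)) powr (1 / (1 - 1 / p))) \<le> max K3 K4 powr (1 / (1 - 1 / p))" for n
      using K3(2)[of n] K3(1) ab by (elim order_trans) (intro powr_mono2; simp)
    show "(\<Sum>k<n. (K2 * d2 k powr (1 - 1 / p)) powr (1 / (1 / q))) \<le> max K3 K4 powr (1 / (1 / q))" for n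
      using K4(2)[of n] K4(1) ab by (elim order_trans) (intro powr_mono2; simp)
    fix Q R :: "(real ^ 'n) set" and k :: nat
    assume QR: "Q \<in> cubes" "R \<in> sets lebesgue" "R \<subseteq> Q" "2 ^ k * measure lebesgue R \<le> measure lebesgue Q"
    show "measure lebesgue Q powr (- \<kappa>) * (LINT x:Q|lebesgue. \<sigma> x) powr (1 - 1 / p) *
        (LINT x:R|lebesgue. u x) powr (1 / q) \<le> K1 * d1 k powr (1 / q)"
      using bump_condition_tail[of q \<delta> p' u \<sigma> Q R k K1, OF pos(1,2,3) assms(7,8) QR K1(1) K1(2)[OF QR(1)]]
      unfolding exponent unfolding p'(2) d1_def .
    show "measure lebesgue Q powr (- \<kappa>) * (LINT x:Q|lebesgue. u x) powr (1 / q) *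
        (LINT x:R|lebesgue. \<sigma> x) powr (1 - 1 / p) \<le> K2 * d2 k powr (1 - 1 / p)"
      using bump_condition_tail[of p' \<delta> q \<sigma> u Q R k K2, OF pos(4,5,6) assms(8,7) QR K2(1) K2(2)[OF QR(1)]]
      unfolding exponent unfolding p'(2) d2_def .
  qed (use ab \<kappa> K3(1) assms(7,8) in auto)
  show ?thesis using riesz_two_weight[OF assms(2) \<kappa>_def] by simp
qed

end
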